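(* Let $A\in\{\mathbb{H},\mathbb{O}\}$ and let $\Omega=\Omega_D^A$ be a basic domain. Every purely vectorial slice regular function $u\in\mathcal{S}(\Omega)$ admits a model.
   Context: $A$ is the algebra $\mathbb{H}$ of quaternions or $\mathbb{O}$ of octonions, with standard conjugation $x\mapsto x^c$; $n=\dim_{\mathbb{R}}A-1$, and $1,e_1,\dots,e_n$ is the standard orthonormal basis ($e_\ell^2=-1$). $\mathbb{S}_A=\{I\in A: I^2=-1\}$, $\mathbb{C}_I=\operatorname{span}_{\mathbb{R}}\{1,I\}$, $\mathbb{C}_I^+=\{x+yI:x\in\mathbb{R},y>0\}$. $A_{\mathbb{C}}=A\otimes_{\mathbb{R}}\mathbb{C}$, with elements $a+\sqrt{-1}\,b$ ($a,b\in A$), complex conjugation $\overline{a+\sqrt{-1}b}=a-\sqrt{-1}b$ and $(a+\sqrt{-1}b)^c=a^c+\sqrt{-1}b^c$. For a nonempty open $D\subset\mathbb{C}$ with $\overline D=D$ (invariant under complex conjugation), $\Omega_D^A=\{\alpha+\beta I:\alpha+\sqrt{-1}\beta\in D,\ I\in\mathbb{S}_A\}$; a circular domain is a connected set $\Omega$ of this form, and it is a basic domain if $\Omega\cap\mathbb{C}_J^+$ is simply connected for every $J\in\mathbb{S}_A$. A stem function is $F=F_1+\sqrt{-1}F_2:D\to A_{\mathbb{C}}$ with $F(\bar z)=\overline{F(z)}$. It induces $f=\mathcal{I}(F):\Omega_D^A\to A$, $f(\alpha+I\beta)=F_1(\alpha+\sqrt{-1}\beta)+I\,F_2(\alpha+\sqrt{-1}\beta)$;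 $f$ is slice regular if $F$ is holomorphic, and $\mathcal{S}(\Omega)$ is the set of slice regular functions. $\mathcal{I}(F)*\mathcal{I}(G)=\mathcal{I}(FG)$, $f^c=\mathcal{I}(F^c)$, $\operatorname{Tr}(f)=f+f^c$, $N(f)=f*f^c$. $f$ is slice preserving if $F$ is $\mathbb{C}$-valued. Every $f\in\mathcal{S}(\Omega)$ is uniquely $f=f_0+\sum_{\ell=1}^n f_\ell e_\ell$ with $f_\ell=\mathcal{I}(F_\ell)$ slice preserving; $f_v=\sum_{\ell\ge1}f_\ell e_\ell$ is its vector part, and $f$ is purely vectorial if $f_0\equiv0$. The central divisor $\operatorname{cdiv}(f)$ is the divisor $\sum_{p\in D}\min_{1\le\ell\le n}\operatorname{ord}_p(F_\ell)\,[p]$ on $D$ (orders are $+\infty$ everywhere if $f_v\equiv0$). Two functions $f,g\in\mathcal{S}(\Omega)$ are strongly equivalent if $\operatorname{Tr}(f)=\operatorname{Tr}(g)$, $N(f)=N(g)$ and $\operatorname{cdiv}(f)=\operatorname{cdiv}(g)$. If $f$ vanishes at a nonreal $q=\alpha+\beta J$, its zero set meets $\mathbb{S}_q=\{\alpha+\beta K:K\in\mathbb{S}_A\}$ either only in $q$ (an isolated nonreal zero) or in all of $\mathbb{S}_q$ (a spherical zero). A model for $f$ is a $g\in\mathcal{S}(\Omega)$ strongly equivalent to $f$ such that all isolated nonreal zeros of $g$ lie in a single slice $\mathbb{C}_I$, for some $I\in\mathbb{S}_A$. *)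

theory Defs
  imports "HOL-Complex_Analysis.Complex_Analysis" "HOL-Library.Extended_Nat"
begin

text \<open>
  The quaternions are obtained from the complex numbers, and the octonions from the quaternions, by
  the Cayley--Dickson doubling $(a,b)(x,y) = (ax - y^c b,\; ya + bx^c)$, $(a,b)^c = (a^c,-b)$.
  The norm, the topology and the standard orthonormal basis are those of the product type:
  \<^const>\<open>Basis\<close> is $\{1, e_1, \dots, e_n\}$ with $1 = (1,0)$; for the quaternions
  $i = (\mathrm{i},0)$, $j = (0,1)$, $k = ij = (0,\mathrm{i})$.
\<close>

definition cd_mult ::
    "('a \<Rightarrow> 'a \<Rightarrow> 'a) \<Rightarrow> ('a \<Rightarrow> 'a) \<Rightarrow> 'a::ab_group_add \<times> 'a \<Rightarrow> 'a \<times> 'a \<Rightarrow> 'a \<times> 'a" where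
  "cd_mult m c p q =
     (m (fst p) (fst q) - m (c (snd q)) (snd p), m (snd q) (fst p) + m (snd p) (c (fst q)))"

definition cd_conj :: "('a \<Rightarrow> 'a) \<Rightarrow> 'a::ab_group_add \<times> 'a \<Rightarrow> 'a \<times> 'a" where
  "cd_conj c p = (c (fst p), - snd p)"

type_synonym quaternion = "complex \<times> complex"
type_synonym octonion = "quaternion \<times> quaternion"

definition quat_mult :: "quaternion \<Rightarrow> quaternion \<Rightarrow> quaternion" where
  "quat_mult = cd_mult (*) cnj"

definition quat_conj :: "quaternion \<Rightarrow> quaternion" where
  "quat_conj = cd_conj cnj"

definition quat_one :: quaternion where
  "quat_one = (1, 0)"

definition oct_mult :: "octonion \<Rightarrow> octonion \<Rightarrow> octonion" where
  "oct_mult = cd_mult quat_mult quat_conj"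

definition oct_conj :: "octonion \<Rightarrow> octonion" where
  "oct_conj = cd_conj quat_conj"

definition oct_one :: octonion where
  "oct_one = (quat_one, 0)"

text \<open>The order of vanishing at \<open>p\<close> of a function holomorphic near \<open>p\<close>.\<close>

definition vanishing_order :: "(complex \<Rightarrow> complex) \<Rightarrow> complex \<Rightarrow> enat" where
  "vanishing_order h p =
     (if \<forall>\<^sub>F w in nhds p. h w = 0 then \<infinity> else enat (nat (zorder h p)))"

text \<open>
  The notions of slice analysis, for an algebra $A$ that will be the quaternions or the octonions.
  An element $a + \sqrt{-1}\,b$ of $A_{\mathbb C}$ is the pair \<open>(a, b)\<close>. A function
  on a subset is a total function whose values elsewhere are irrelevant; since $\Omega_D$
  determines and is determined by the conjugation-invariant set \<open>D\<close>, the notions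
  depending on the domain are indexed by \<open>D\<close>.
\<close>

locale slice_algebra =
  fixes mult :: "'a::euclidean_space \<Rightarrow> 'a \<Rightarrow> 'a" (infixl "\<odot>" 70)
    and conj :: "'a \<Rightarrow> 'a"
    and one :: 'a
begin

definition imag_units :: "'a set" where
  "imag_units = {I. I \<odot> I = - one}"

definition slice :: "'a \<Rightarrow> 'a set" where
  "slice I = span {one, I}"

definition half_slice :: "'a \<Rightarrow> 'a set" where
  "half_slice I = {x *\<^sub>R one + y *\<^sub>R I | x y. y > 0}"

definition circular_set :: "complex set \<Rightarrow> 'a set" where
  "circular_set D =
     {\<alpha> *\<^sub>R one + \<beta> *\<^sub>R I | \<alpha> \<beta> I. Complex \<alpha> \<beta> \<in> D \<and> I \<in> imag_units}"

definition circular_domain :: "complex set \<Rightarrow> bool" where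
  "circular_domain D \<longleftrightarrow> open D \<and> D \<noteq> {} \<and> cnj ` D = D \<and> connected (circular_set D)"

definition basic_domain :: "complex set \<Rightarrow> bool" where
  "basic_domain D \<longleftrightarrow> circular_domain D \<and>
     (\<forall>J\<in>imag_units. simply_connected (circular_set D \<inter> half_slice J))"

definition complexified_mult :: "'a \<times> 'a \<Rightarrow> 'a \<times> 'a \<Rightarrow> 'a \<times> 'a" where
  "complexified_mult v w =
     (fst v \<odot> fst w - snd v \<odot> snd w, fst v \<odot> snd w + snd v \<odot> fst w)"

definition complexified_conj :: "'a \<times> 'a \<Rightarrow> 'a \<times> 'a" where
  "complexified_conj w = (conj (fst w), conj (snd w))"

definition complex_bar :: "'a \<times> 'a \<Rightarrow> 'a \<times> 'a" where
  "complex_bar w = (fst w, - snd w)"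

text \<open>The coordinate in $\mathbb C$ of an element of $A_{\mathbb C}$ along the basis vector \<open>e\<close>.\<close>

definition coord :: "'a \<Rightarrow> 'a \<times> 'a \<Rightarrow> complex" where
  "coord e w = Complex (fst w \<bullet> e) (snd w \<bullet> e)"

definition complex_embed :: "complex \<Rightarrow> 'a \<times> 'a" where
  "complex_embed c = (Re c *\<^sub>R one, Im c *\<^sub>R one)"

definition stem_function :: "complex set \<Rightarrow> (complex \<Rightarrow> 'a \<times> 'a) \<Rightarrow> bool" where
  "stem_function D F \<longleftrightarrow> (\<forall>z\<in>D. F (cnj z) = complex_bar (F z))"

definition holomorphic_stem :: "complex set \<Rightarrow> (complex \<Rightarrow> 'a \<times> 'a) \<Rightarrow> bool" where
  "holomorphic_stem D F \<longleftrightarrow>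
     stem_function D F \<and> (\<forall>e\<in>Basis. (\<lambda>z. coord e (F z)) holomorphic_on D)"

text \<open>
  For a stem function the value below does not depend on the representation of \<open>x\<close>: a nonreal \<open>x\<close>
  has exactly two, exchanged by \<open>(\<beta>, I) \<mapsto> (- \<beta>, - I)\<close>, and at a real \<open>x\<close> the second component
  of the stem function vanishes.
\<close>

definition induced :: "complex set \<Rightarrow> (complex \<Rightarrow> 'a \<times> 'a) \<Rightarrow> 'a \<Rightarrow> 'a" where
  "induced D F x =
     (THE y. \<exists>\<alpha> \<beta> I. Complex \<alpha> \<beta> \<in> D \<and> I \<in> imag_units \<and> x = \<alpha> *\<^sub>R one + \<beta> *\<^sub>R I \<and>
        y = fst (F (Complex \<alpha> \<beta>)) + I \<odot> snd (F (Complex \<alpha> \<beta>)))"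

definition slice_regular :: "complex set \<Rightarrow> ('a \<Rightarrow> 'a) set" where
  "slice_regular D =
     {f. \<exists>F. holomorphic_stem D F \<and> (\<forall>x\<in>circular_set D. f x = induced D F x)}"

text \<open>The stem function of a slice function; its values on \<open>D\<close> are uniquely determined.\<close>

definition stem_of :: "complex set \<Rightarrow> ('a \<Rightarrow> 'a) \<Rightarrow> complex \<Rightarrow> 'a \<times> 'a" where
  "stem_of D f =
     (SOME F. stem_function D F \<and> (\<forall>x\<in>circular_set D. f x = induced D F x))"

definition slice_product :: "complex set \<Rightarrow> ('a \<Rightarrow> 'a) \<Rightarrow> ('a \<Rightarrow> 'a) \<Rightarrow> 'a \<Rightarrow> 'a" where
  "slice_product D f g = induced D (\<lambda>z. complexified_mult (stem_of D f z) (stem_of D g z))"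

definition slice_conj :: "complex set \<Rightarrow> ('a \<Rightarrow> 'a) \<Rightarrow> 'a \<Rightarrow> 'a" where
  "slice_conj D f = induced D (\<lambda>z. complexified_conj (stem_of D f z))"

definition slice_trace :: "complex set \<Rightarrow> ('a \<Rightarrow> 'a) \<Rightarrow> 'a \<Rightarrow> 'a" where
  "slice_trace D f = (\<lambda>x. f x + slice_conj D f x)"

definition slice_norm :: "complex set \<Rightarrow> ('a \<Rightarrow> 'a) \<Rightarrow> 'a \<Rightarrow> 'a" where
  "slice_norm D f = slice_product D f (slice_conj D f)"

text \<open>
  The slice preserving components $f_\ell$ of $f = f_0 + \sum_\ell f_\ell e_\ell$, indexed by the
  basis vector.
\<close>

definition slice_component :: "complex set \<Rightarrow> ('a \<Rightarrow> 'a) \<Rightarrow> 'a \<Rightarrow> 'a \<Rightarrow> 'a" where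
  "slice_component D f e = induced D (\<lambda>z. complex_embed (coord e (stem_of D f z)))"

definition purely_vectorial :: "complex set \<Rightarrow> ('a \<Rightarrow> 'a) \<Rightarrow> bool" where
  "purely_vectorial D f \<longleftrightarrow> (\<forall>x\<in>circular_set D. slice_component D f one x = 0)"

text \<open>A divisor on \<open>D\<close> is represented by its multiplicity function, extended by 0.\<close>

definition central_divisor :: "complex set \<Rightarrow> ('a \<Rightarrow> 'a) \<Rightarrow> complex \<Rightarrow> enat" where
  "central_divisor D f p =
     (if p \<in> D
      then Min ((\<lambda>e. vanishing_order (\<lambda>z. coord e (stem_of D f z)) p) ` (Basis - {one}))
      else 0)"

definition strongly_equivalent :: "complex set \<Rightarrow> ('a \<Rightarrow> 'a) \<Rightarrow> ('a \<Rightarrow> 'a) \<Rightarrow> bool" where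
  "strongly_equivalent D f g \<longleftrightarrow> f \<in> slice_regular D \<and> g \<in> slice_regular D \<and>
     (\<forall>x\<in>circular_set D. slice_trace D f x = slice_trace D g x) \<and>
     (\<forall>x\<in>circular_set D. slice_norm D f x = slice_norm D g x) \<and>
     central_divisor D f = central_divisor D g"

definition sphere_of :: "'a \<Rightarrow> 'a set" where
  "sphere_of q =
     {\<alpha> *\<^sub>R one + \<beta> *\<^sub>R K | \<alpha> \<beta> K.
        K \<in> imag_units \<and> (\<exists>J\<in>imag_units. q = \<alpha> *\<^sub>R one + \<beta> *\<^sub>R J)}"

definition isolated_nonreal_zero :: "complex set \<Rightarrow> ('a \<Rightarrow> 'a) \<Rightarrow> 'a \<Rightarrow> bool" where
  "isolated_nonreal_zero D f q \<longleftrightarrow>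
     q \<in> circular_set D \<and> q \<notin> span {one} \<and> {x \<in> sphere_of q. f x = 0} = {q}"

definition is_model :: "complex set \<Rightarrow> ('a \<Rightarrow> 'a) \<Rightarrow> ('a \<Rightarrow> 'a) \<Rightarrow> bool" where
  "is_model D f g \<longleftrightarrow> g \<in> slice_regular D \<and> strongly_equivalent D g f \<and>
     (\<exists>I\<in>imag_units. \<forall>q. isolated_nonreal_zero D g q \<longrightarrow> q \<in> slice I)"

end

global_interpretation quat: slice_algebra quat_mult quat_conj quat_one .

global_interpretation oct: slice_algebra oct_mult oct_conj oct_one .

end

theory Submission imports Defs begin

text \<open>
  Write $F = \sum_\ell F_\ell e_\ell$ for the stem function of \<open>u\<close>. A model is sought with stem function
  $g_1 e_1 + g_2 e_2$: at an isolated zero $\alpha + \beta J$ of such a function, \<open>J\<close> is a real linear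
  combination of $1$ and $e_1 e_2$, so all isolated nonreal zeros lie in the slice of $e_1 e_2$. With
  $h = g_1 + \mathrm{i} g_2$ and $h^*(z) = \overline{h(\bar z)}$, strong equivalence becomes
  $h h^* = N := \sum_\ell F_\ell^2$ and $\min(\mathrm{ord}\,h, \mathrm{ord}\,h^*) = m := \min_\ell \mathrm{ord}\,F_\ell$.
  By the Weierstrass product theorem there is $a$ on \<open>D\<close> with order $m$ on the closed upper half and
  $\mathrm{ord}\,N - m$ on the open lower half; this gives $N = a a^* v$ with \<open>v\<close> free of zeros and positive
  at the real points, and $h = a \sqrt v$, where the root exists since the upper half of \<open>D\<close> is
  simply connected. If \<open>N\<close> vanishes identically but \<open>u\<close> does not, then \<open>D\<close> has no real points, and \<open>h\<close>
  may be taken to be zero on the lower half.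
\<close>

section \<open>Orders of vanishing\<close>

text \<open>One component does not suffice: \<open>N\<close> may have odd order at a nonreal point,
  or order greater than 2m, so a root of \<open>N\<close> along \<open>e1\<close> need not exist or
  has the wrong central divisor. With two components the task is to distribute the zeros of
  \<open>N\<close> between h and h*. Where \<open>N\<close> has finite order M at p, the orders of h
  and h* at p add up to M and have minimum m, so they are m and M - m; only the choice of which
  conjugate point gets which remains. At a real point h and h* have equal orders, so M = 2m is
  needed there; it holds since the components are real on the real axis, where their squares cannot
  cancel. Traces need no attention, both functions being purely vectorial. What is left once the
  zeros are placed is a unit \<open>v\<close>, whose root has to be found on a set that may be
  neither connected nor simply connected. Positivity of \<open>v\<close> at the real points is what
  makes the branches from the two sides fit together.\<close>

lemma analytic_at_holomorphic_on:
  assumes "f holomorphic_on D" "open D" "p \<in> D"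
  shows "f analytic_on {p}"
  using assms analytic_at by blast

lemma eventually_at_nonzero:
  assumes "g analytic_on {p}" "g p \<noteq> 0"
  shows "\<forall>\<^sub>F w in at p. g w \<noteq> 0"
proof (rule tendsto_imp_eventually_ne)
  show "g \<midarrow>p\<rightarrow> g p" using analytic_at_imp_isCont[OF assms(1)] by (simp add: isCont_def)
qed (rule assms(2))

text \<open>Off \<open>p\<close> the power cancels, which leaves \<open>g\<close> zero on a
  punctured neighbourhood; the value at \<open>p\<close> itself follows by continuity.\<close>

lemma eventually_nhds_zeroI:
  assumes "g analytic_on {p}" "\<forall>\<^sub>F w in nhds p. f w = (w - p) ^ k * g w" "\<forall>\<^sub>F w in nhds p. f w = 0"
  shows "\<forall>\<^sub>F w in nhds p. g w = (0::complex)"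
proof -
  have "\<forall>\<^sub>F w in at p. g w = 0"
    unfolding eventually_at_filter using assms(2,3)
  proof eventually_elim
    case (elim w)
    hence "(w - p) ^ k * g w = 0" by simp
    thus ?case by auto
  qed
  moreover have "g \<midarrow>p\<rightarrow> g p"
    using analytic_at_imp_isCont[OF assms(1)] by (simp add: isCont_def)
  ultimately have "g p = 0"
    by (metis tendsto_eventually tendsto_unique trivial_limit_at)
  with \<open>\<forall>\<^sub>F w in at p. g w = 0\<close> show ?thesis
    by (auto simp: eventually_at_filter elim!: eventually_mono)
qed

text \<open>Together with its converse below, this trades \<open>zorder\<close> for a factorization
  (w - p)^k g with g(p) nonzero, the form in which orders are mostly computed.\<close>

lemma vanishing_order_eqI:
  assumes g: "g analytic_on {p}" "g p \<noteq> 0" and f: "\<forall>\<^sub>F w in nhds p. f w = (w - p) ^ k * g w"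
  shows "vanishing_order f p = enat k"
proof -
  have "\<not> (\<forall>\<^sub>F w in nhds p. f w = 0)"
    using eventually_nhds_zeroI[OF g(1) f] g(2) eventually_nhds_x_imp_x by blast
  moreover have "zorder f p = int k"
  proof -
    obtain S where S: "open S" "p \<in> S" "g holomorphic_on S"
      using g(1) analytic_at by blast
    obtain T where T: "open T" "p \<in> T" "\<And>w. w \<in> T \<Longrightarrow> f w = (w - p) ^ k * g w"
      using f unfolding eventually_nhds by blast
    show ?thesis
      by (rule zorder_eqI[of "S \<inter> T" p g])
         (use S T g in \<open>auto intro: holomorphic_on_subset simp: mult.commute\<close>)
  qed
  ultimately show ?thesis
    by (simp add: vanishing_order_def)
qed

lemma vanishing_order_eqE:
  assumes f: "f analytic_on {p}" and k: "vanishing_order f p = enat k"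
  obtains g where "g analytic_on {p}" "g p \<noteq> 0" "\<forall>\<^sub>F w in nhds p. f w = (w - p) ^ k * g w"
proof -
  have nz: "\<not> (\<forall>\<^sub>F w in nhds p. f w = 0)" and zk: "nat (zorder f p) = k"
    using k by (auto simp: vanishing_order_def split: if_splits)
  obtain r where r: "r > 0" "f holomorphic_on ball p r"
    using f by (auto simp: analytic_on_def)
  have "\<exists>w\<in>ball p r. f w \<noteq> 0"
  proof (rule ccontr)
    assume *: "\<not> ?thesis"
    have "\<forall>\<^sub>F w in nhds p. w \<in> ball p r"
      by (rule eventually_nhds_in_open) (use r(1) in auto)
    hence "\<forall>\<^sub>F w in nhds p. f w = 0" by eventually_elim (use * in blast)
    with nz show False by blast
  qed
  then obtain s where s: "s > 0" "zor_poly f p holomorphic_on cball p s"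
      "\<And>w. w \<in> cball p s \<Longrightarrow> f w = zor_poly f p w * (w - p) ^ nat (zorder f p) \<and> zor_poly f p w \<noteq> 0"
    using zorder_exist_zero[of f "ball p r" p, OF r(2)] r(1) by (metis centre_in_ball connected_ball open_ball)
  show ?thesis
  proof (rule that)
    show "zor_poly f p analytic_on {p}"
      using s(1,2) by (meson ball_subset_cball analytic_at centre_in_ball holomorphic_on_subset open_ball)
    show "zor_poly f p p \<noteq> 0"
      using s(1) s(3)[of p] by auto
    have "\<forall>\<^sub>F w in nhds p. w \<in> ball p s"
      by (rule eventually_nhds_in_open) (use s(1) in auto)
    thus "\<forall>\<^sub>F w in nhds p. f w = (w - p) ^ k * zor_poly f p w"
      by eventually_elim (use s(3) zk in \<open>auto simp: mult.commute\<close>)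
  qed
qed

text \<open>Divisibility by (w - p)^k covers infinite order as well, with cofactor 0. In this form a
  common power can be taken out of several functions at once.\<close>

lemma enat_le_vanishing_order_iff:
  assumes f: "f analytic_on {p}"
  shows "enat k \<le> vanishing_order f p \<longleftrightarrow>
    (\<exists>g. g analytic_on {p} \<and> (\<forall>\<^sub>F w in nhds p. f w = (w - p) ^ k * g w))" (is "_ = ?R")
proof (cases "vanishing_order f p")
  case (enat n)
  then obtain h where h: "h analytic_on {p}" "h p \<noteq> 0" "\<forall>\<^sub>F w in nhds p. f w = (w - p) ^ n * h w"
    using vanishing_order_eqE[OF f] by metis
  have "k \<le> n" if g: "g analytic_on {p}" "\<forall>\<^sub>F w in nhds p. f w = (w - p) ^ k * g w" for g
  proof (rule ccontr)
    assume "\<not> k \<le> n"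
    \<comment> \<open>Splitting \<open>k\<close> this way leaves at least one factor w - p in the
      first term of \<open>G\<close>, so \<open>G p\<close> is \<open>- h p\<close>, which is not
      0.\<close>
    hence kn: "k = n + Suc (k - Suc n)" by simp
    define G where "G = (\<lambda>w. (w - p) ^ Suc (k - Suc n) * g w - h w)"
    have "G analytic_on {p}"
      unfolding G_def by (intro analytic_intros g h)
    moreover have "\<forall>\<^sub>F w in nhds p. (0::complex) = (w - p) ^ n * G w"
      using g(2) h(3) by eventually_elim
        (subst (asm) kn, simp add: G_def power_add algebra_simps)
    ultimately have "\<forall>\<^sub>F w in nhds p. G w = 0"
      by (rule eventually_nhds_zeroI) simp
    hence "G p = 0" by (rule eventually_nhds_x_imp_x)
    with h(2) show False by (simp add: G_def)
  qed
  moreover have ?R if "k \<le> n"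
  proof (intro exI[of _ "\<lambda>w. (w - p) ^ (n - k) * h w"] conjI)
    show "(\<lambda>w. (w - p) ^ (n - k) * h w) analytic_on {p}"
      by (intro analytic_intros h)
    have "(w - p) ^ n = (w - p) ^ k * (w - p) ^ (n - k)" for w
      using that by (simp flip: power_add)
    thus "\<forall>\<^sub>F w in nhds p. f w = (w - p) ^ k * ((w - p) ^ (n - k) * h w)"
      using h(3) by (auto simp: mult.assoc)
  qed
  ultimately show ?thesis
    using enat by auto
next
  case infinity
  hence "\<forall>\<^sub>F w in nhds p. f w = (w - p) ^ k * 0"
    by (auto simp: vanishing_order_def split: if_splits)
  moreover have "(\<lambda>w. 0) analytic_on {p}" by (simp add: analytic_on_const)
  ultimately have ?R by blast
  with infinity show ?thesis by simp
qed

lemma vanishing_order_eq_infinity_iff: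
  "vanishing_order f p = \<infinity> \<longleftrightarrow> (\<forall>\<^sub>F w in nhds p. f w = 0)"
  by (simp add: vanishing_order_def)

lemma vanishing_order_cong:
  assumes "\<forall>\<^sub>F w in nhds p. f w = g w"
  shows "vanishing_order f p = vanishing_order g p"
proof -
  have "(\<forall>\<^sub>F w in nhds p. f w = 0) \<longleftrightarrow> (\<forall>\<^sub>F w in nhds p. g w = 0)"
    by (rule eventually_cong[OF assms]) simp
  moreover have "zorder f p = zorder g p"
    by (rule zorder_cong) (use assms in \<open>auto simp: eventually_at_filter elim: eventually_mono\<close>)
  ultimately show ?thesis by (simp add: vanishing_order_def)
qed

lemma vanishing_order_eq_0_iff:
  assumes "f analytic_on {p}"
  shows "vanishing_order f p = 0 \<longleftrightarrow> f p \<noteq> 0"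
proof
  assume "f p \<noteq> 0"
  thus "vanishing_order f p = 0"
    using vanishing_order_eqI[of f p f 0] assms by (simp add: zero_enat_def)
next
  assume "vanishing_order f p = 0"
  then obtain g where "g p \<noteq> 0" "\<forall>\<^sub>F w in nhds p. f w = (w - p) ^ 0 * g w"
    using vanishing_order_eqE[OF assms] zero_enat_def by metis
  thus "f p \<noteq> 0" using eventually_nhds_x_imp_x by fastforce
qed

lemma vanishing_order_mult:
  assumes f: "f analytic_on {p}" and g: "g analytic_on {p}"
  shows "vanishing_order (\<lambda>w. f w * g w) p = vanishing_order f p + vanishing_order g p"
proof (cases "vanishing_order f p = \<infinity> \<or> vanishing_order g p = \<infinity>")
  case True
  hence "\<forall>\<^sub>F w in nhds p. f w * g w = 0"
    by (auto simp: vanishing_order_eq_infinity_iff elim: eventually_mono)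
  hence "vanishing_order (\<lambda>w. f w * g w) p = \<infinity>"
    by (simp add: vanishing_order_eq_infinity_iff)
  with True show ?thesis by auto
next
  case False
  then obtain m n where mn: "vanishing_order f p = enat m" "vanishing_order g p = enat n"
    by auto
  obtain f1 where f1: "f1 analytic_on {p}" "f1 p \<noteq> 0" "\<forall>\<^sub>F w in nhds p. f w = (w - p) ^ m * f1 w"
    using vanishing_order_eqE[OF f mn(1)] .
  obtain g1 where g1: "g1 analytic_on {p}" "g1 p \<noteq> 0" "\<forall>\<^sub>F w in nhds p. g w = (w - p) ^ n * g1 w"
    using vanishing_order_eqE[OF g mn(2)] .
  have "vanishing_order (\<lambda>w. f w * g w) p = enat (m + n)"
  proof (rule vanishing_order_eqI)
    show "(\<lambda>w. f1 w * g1 w) analytic_on {p}" by (intro analytic_intros f1 g1)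
    show "f1 p * g1 p \<noteq> 0" using f1 g1 by simp
    show "\<forall>\<^sub>F w in nhds p. f w * g w = (w - p) ^ (m + n) * (f1 w * g1 w)"
      using f1(3) g1(3) by eventually_elim (simp add: power_add)
  qed
  with mn show ?thesis by simp
qed

lemma enat_le_vanishing_order_linear:
  assumes f: "f analytic_on {p}" and g: "g analytic_on {p}"
    and "enat k \<le> vanishing_order f p" "enat k \<le> vanishing_order g p"
  shows "enat k \<le> vanishing_order (\<lambda>w. a * f w + b * g w) p"
proof -
  obtain f1 where f1: "f1 analytic_on {p}" "\<forall>\<^sub>F w in nhds p. f w = (w - p) ^ k * f1 w"
    using assms enat_le_vanishing_order_iff by metis
  obtain g1 where g1: "g1 analytic_on {p}" "\<forall>\<^sub>F w in nhds p. g w = (w - p) ^ k * g1 w"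
    using assms enat_le_vanishing_order_iff by metis
  have "(\<lambda>w. a * f1 w + b * g1 w) analytic_on {p}" by (intro analytic_intros f1 g1)
  moreover have "\<forall>\<^sub>F w in nhds p. a * f w + b * g w = (w - p) ^ k * (a * f1 w + b * g1 w)"
    using f1(2) g1(2) by eventually_elim (simp add: algebra_simps)
  moreover have "(\<lambda>w. a * f w + b * g w) analytic_on {p}" by (intro analytic_intros f g)
  ultimately show ?thesis using enat_le_vanishing_order_iff by blast
qed

text \<open>Needed in both directions between the pairs \<open>h\<close>,
  \<open>cnj_reflect h\<close> and \<open>g1\<close>, \<open>g2\<close>, which are linear
  combinations of each other.\<close>

lemma vanishing_order_linear_ge:
  assumes f: "f analytic_on {p}" and g: "g analytic_on {p}"
  shows "min (vanishing_order f p) (vanishing_order g p) \<le> vanishing_order (\<lambda>w. a * f w + b * g w) p"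
    (is "?m \<le> ?v")
proof (cases ?m)
  case (enat k)
  hence "enat k \<le> vanishing_order f p" "enat k \<le> vanishing_order g p"
    by (auto simp: min_def split: if_splits)
  thus ?thesis
    using enat_le_vanishing_order_linear[OF f g] enat by simp
next
  case infinity
  hence "vanishing_order f p = \<infinity>" "vanishing_order g p = \<infinity>"
    by (auto simp: min_def split: if_splits)
  hence "\<forall>\<^sub>F w in nhds p. f w = 0" "\<forall>\<^sub>F w in nhds p. g w = 0"
    by (auto simp: vanishing_order_eq_infinity_iff)
  hence "\<forall>\<^sub>F w in nhds p. a * f w + b * g w = 0"
    by eventually_elim simp
  thus ?thesis by (simp add: vanishing_order_def)
qed

section \<open>Reflection in the real axis\<close>

lemma eventually_nhds_cnj_iff:
  "(\<forall>\<^sub>F w in nhds (cnj p). P w) \<longleftrightarrow> (\<forall>\<^sub>F w in nhds p. P (cnj w))"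
proof -
  have *: "\<forall>\<^sub>F w in nhds q. Q (cnj w)" if "\<forall>\<^sub>F w in nhds (cnj q). Q w" for Q q
  proof -
    have "filterlim cnj (nhds (cnj q)) (nhds q)"
      using filterlim_ident tendsto_cnj by blast
    thus ?thesis using that by (auto simp: filterlim_iff)
  qed
  show ?thesis
    using *[of P p] *[of "\<lambda>w. P (cnj w)" "cnj p"] by auto
qed

text \<open>This is h* of the overview. The functions it fixes are those with conjugate values at
  conjugate points, which is the stem condition for complex-valued functions.\<close>

definition cnj_reflect :: "(complex \<Rightarrow> complex) \<Rightarrow> complex \<Rightarrow> complex" where
  "cnj_reflect h z = cnj (h (cnj z))"

lemma holomorphic_on_cnj_reflect:
  assumes "f holomorphic_on D" "open D" "cnj ` D = D"
  shows "cnj_reflect f holomorphic_on D"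
  using holomorphic_on_compose_cnj_cnj[of f D] assms by (simp add: cnj_reflect_def[abs_def] o_def)

lemma analytic_at_cnj_reflect:
  assumes "f analytic_on {cnj p}"
  shows "cnj_reflect f analytic_on {p}"
proof -
  obtain S where S: "open S" "cnj p \<in> S" "f holomorphic_on S"
    using assms analytic_at by blast
  have o: "open (cnj ` S)"
    using S(1) by (simp add: image_cnj_conv_vimage_cnj open_vimage continuous_intros)
  have "cnj ` (cnj ` S) = S" by (auto simp: image_image)
  hence "cnj_reflect f holomorphic_on (cnj ` S)"
    using holomorphic_on_compose_cnj_cnj[of f "cnj ` S"] S o
    by (simp add: cnj_reflect_def[abs_def] o_def)
  moreover have "p \<in> cnj ` S" using S(2) by (metis complex_cnj_cnj imageI)
  ultimately show ?thesis using o analytic_at by blast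
qed

lemma vanishing_order_cnj_reflect:
  assumes "f analytic_on {cnj p}"
  shows "vanishing_order (cnj_reflect f) p = vanishing_order f (cnj p)"
proof (cases "vanishing_order f (cnj p)")
  case (enat k)
  then obtain g where g: "g analytic_on {cnj p}" "g (cnj p) \<noteq> 0"
      "\<forall>\<^sub>F w in nhds (cnj p). f w = (w - cnj p) ^ k * g w"
    using vanishing_order_eqE[OF assms] by metis
  have "vanishing_order (cnj_reflect f) p = enat k"
  proof (rule vanishing_order_eqI)
    show "cnj_reflect g analytic_on {p}" by (rule analytic_at_cnj_reflect) fact
    show "cnj_reflect g p \<noteq> 0" using g(2) by (simp add: cnj_reflect_def)
    have "\<forall>\<^sub>F w in nhds p. f (cnj w) = (cnj w - cnj p) ^ k * g (cnj w)"
      using g(3) by (subst (asm) eventually_nhds_cnj_iff)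
    thus "\<forall>\<^sub>F w in nhds p. cnj_reflect f w = (w - p) ^ k * cnj_reflect g w"
      by eventually_elim (simp add: cnj_reflect_def)
  qed
  with enat show ?thesis by simp
next
  case infinity
  hence "\<forall>\<^sub>F w in nhds p. f (cnj w) = 0"
    using eventually_nhds_cnj_iff by (simp add: vanishing_order_eq_infinity_iff)
  hence "\<forall>\<^sub>F w in nhds p. cnj_reflect f w = 0"
    by eventually_elim (simp add: cnj_reflect_def)
  thus ?thesis using infinity by (simp add: vanishing_order_def)
qed

section \<open>The Weierstrass product theorem on an open set\<close>

text \<open>The M-test gives locally uniform convergence of the partial products. The index from
  which \<open>M n\<close> is a bound may depend on the compact set, since the finitely many factors
  far from 1 do.\<close>

lemma
  fixes u :: "nat \<Rightarrow> complex \<Rightarrow> complex"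
  assumes D: "open D" and hol: "\<And>n. u n holomorphic_on D" and M: "summable M"
    and bound: "\<And>K. compact K \<Longrightarrow> K \<subseteq> D \<Longrightarrow> \<forall>\<^sub>F n in sequentially. \<forall>z\<in>K. norm (u n z - 1) \<le> M n"
  shows has_prod_normally_convergent: "z \<in> D \<Longrightarrow> (\<lambda>n. u n z) has_prod (\<Prod>n. u n z)"
    and holomorphic_on_normally_convergent_prod: "(\<lambda>z. \<Prod>n. u n z) holomorphic_on D"
proof -
  have conv: "convergent_prod (\<lambda>n. u n z)" if "z \<in> D" for z
  proof -
    have "abs_convergent_prod (\<lambda>n. u n z)"
      unfolding abs_convergent_prod_conv_summable
    proof (rule summable_comparison_test_ev[OF _ M])
      show "\<forall>\<^sub>F n in sequentially. norm (norm (u n z - 1)) \<le> M n"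
        using bound[of "{z}"] that by simp
    qed
    thus ?thesis by (rule abs_convergent_prod_imp_convergent_prod)
  qed
  thus "z \<in> D \<Longrightarrow> (\<lambda>n. u n z) has_prod (\<Prod>n. u n z)"
    by (simp add: convergent_prod_has_prod)
  show "(\<lambda>z. \<Prod>n. u n z) holomorphic_on D"
  proof (rule holomorphic_uniform_sequence[OF D])
    show "(\<lambda>z. \<Prod>n<N. u n z) holomorphic_on D" for N
      by (intro holomorphic_intros hol)
    fix x assume "x \<in> D"
    then obtain d where d: "d > 0" "cball x d \<subseteq> D"
      using D open_contains_cball by blast
    have "uniformly_convergent_on (cball x d) (\<lambda>N z. \<Prod>n<N. u n z)"
    proof (rule uniformly_convergent_on_prod')
      show "continuous_on (cball x d) (u n)" for n
        using hol d(2) holomorphic_on_imp_continuous_on holomorphic_on_subset by blast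
      show "uniformly_convergent_on (cball x d) (\<lambda>N z. \<Sum>n<N. norm (u n z - 1))"
        by (rule Weierstrass_m_test'_ev[OF _ M]) (use bound[of "cball x d"] d(2) in simp)
    qed auto
    then obtain g where g: "uniform_limit (cball x d) (\<lambda>N z. \<Prod>n<N. u n z) g sequentially"
      by (auto simp: uniformly_convergent_on_def)
    have "(\<Prod>n. u n z) = g z" if z: "z \<in> cball x d" for z
    proof -
      \<comment> \<open>The shift by one reconciles products over k < N with the library's partial
        products over k \<le> n.\<close>
      have "(\<lambda>n. \<Prod>k<Suc n. u k z) \<longlonglongrightarrow> g z"
        using tendsto_uniform_limitI[OF g z] by (rule LIMSEQ_Suc)
      moreover have "(\<lambda>n. \<Prod>k<Suc n. u k z) \<longlonglongrightarrow> (\<Prod>n. u n z)"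
        using convergent_prod_LIMSEQ[OF conv[of z]] z d(2) unfolding lessThan_Suc_atMost by blast
      ultimately show ?thesis using LIMSEQ_unique by blast
    qed
    hence "uniform_limit (cball x d) (\<lambda>N z. \<Prod>n<N. u n z) (\<lambda>z. \<Prod>n. u n z) sequentially"
      using g by (metis (no_types, lifting) uniform_limit_cong')
    with d show "\<exists>d>0. cball x d \<subseteq> D \<and>
        uniform_limit (cball x d) (\<lambda>N z. \<Prod>n<N. u n z) (\<lambda>z. \<Prod>n. u n z) sequentially"
      by blast
  qed
qed

text \<open>The elementary factor of degree k differs from 1 by at most 3 |x|^(k+1), so it tends to
  1 uniformly on the disc of radius 1/2. The power \<open>d\<close> is the multiplicity of the zero;
  raising the degree compensates for it.\<close>

lemma weierstrass_factor_power_near_1: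
  fixes e :: real
  assumes "e > 0"
  shows "\<exists>k. \<forall>x. norm x \<le> 1 / 2 \<longrightarrow> norm (weierstrass_factor k x ^ d - 1) \<le> e"
proof -
  have "(\<lambda>y::complex. y ^ d) \<midarrow>1\<rightarrow> 1 ^ d" by (intro tendsto_intros)
  then obtain s where s: "s > 0" "\<And>y::complex. y \<noteq> 1 \<Longrightarrow> norm (y - 1) < s \<Longrightarrow> norm (y ^ d - 1) < e"
    using assms unfolding LIM_eq by (metis power_one)
  have "(\<lambda>k. 3 * (1 / 2 :: real) ^ Suc k) \<longlonglongrightarrow> 3 * 0"
    by (intro tendsto_intros LIMSEQ_Suc LIMSEQ_realpow_zero) auto
  hence "\<forall>\<^sub>F k in sequentially. 3 * (1 / 2 :: real) ^ Suc k < s"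
    using s(1) by (intro order_tendstoD) auto
  then obtain k where k: "3 * (1 / 2 :: real) ^ Suc k < s"
    by (auto simp: eventually_sequentially)
  have "norm (weierstrass_factor k x ^ d - 1) \<le> e" if "norm x \<le> 1 / 2" for x
  proof (cases "weierstrass_factor k x = 1")
    case True
    thus ?thesis using assms by simp
  next
    case False
    have "norm (weierstrass_factor k x - 1) \<le> 3 * norm x ^ Suc k"
      by (rule weierstrass_factor_bound) fact
    also have "\<dots> \<le> 3 * (1 / 2) ^ Suc k"
      using that by (intro mult_left_mono power_mono) auto
    also have "\<dots> < s" by fact
    finally show ?thesis using s(2)[OF False] by simp
  qed
  thus ?thesis by blast
qed

text \<open>The quantity \<open>1 - (z - p) * g p z\<close> is the argument of the elementary factor with zero \<open>p\<close>:
  it is \<open>z / p\<close> for the zeros far from the complement of \<open>D\<close>, which can only accumulate at infinity,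
  and \<open>(p - b) / (z - b)\<close> for the others, where \<open>b\<close> is a point of the complement closest to \<open>p\<close>.\<close>

lemma weierstrass_arguments:
  fixes D Z :: "complex set"
  assumes D: "open D" and Z: "Z \<subseteq> D" "\<And>x. x \<in> D \<Longrightarrow> \<not> x islimpt Z"
  shows "\<exists>g. (\<forall>p\<in>Z. g p holomorphic_on D \<and> (\<forall>z\<in>D. g p z \<noteq> 0)) \<and>
    (\<forall>K. compact K \<longrightarrow> K \<subseteq> D \<longrightarrow> finite {p\<in>Z. \<exists>z\<in>K. norm (1 - (z - p) * g p z) > 1 / 2})"
proof -
  have fin: "finite (C \<inter> Z)" if "compact C" "C \<subseteq> D" for C
    using finite_not_islimpt_in_compact[of C Z] that Z(2) by blast
  show ?thesis
  proof (cases "D = UNIV")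
    case True
    \<comment> \<open>Without a complement only the arguments z / p are available. The value at p =
      0 is an arbitrary nonzero constant, harmless because a single zero cannot affect
      finiteness.\<close>
    define g where "g = (\<lambda>(p::complex) (z::complex). if p = 0 then 1 else - 1 / p)"
    have "finite {p\<in>Z. \<exists>z\<in>K. norm (1 - (z - p) * g p z) > 1 / 2}" if K: "compact K" for K
    proof -
      obtain R where R: "R > 0" "\<And>z. z \<in> K \<Longrightarrow> norm z \<le> R"
        using compact_imp_bounded[OF K] bounded_pos by blast
      have "p \<in> cball 0 (2 * R)" if "z \<in> K" "norm (1 - (z - p) * g p z) > 1 / 2" for p z
      proof (cases "p = 0")
        case False
        hence "1 - (z - p) * g p z = z / p" by (simp add: g_def field_simps)
        with that have "norm (z / p) > 1 / 2" by metis
        with False have "norm p < 2 * norm z" by (simp add: norm_divide field_simps)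
        with R(2)[OF that(1)] show ?thesis by simp
      qed (use R in auto)
      hence "{p\<in>Z. \<exists>z\<in>K. norm (1 - (z - p) * g p z) > 1 / 2} \<subseteq> cball 0 (2 * R) \<inter> Z" by blast
      moreover have "finite (cball 0 (2 * R) \<inter> Z)" by (rule fin) (use True in auto)
      ultimately show ?thesis by (rule finite_subset)
    qed
    thus ?thesis
      by (intro exI[of _ g]) (auto simp: g_def)
  next
    case False
    define B where "B = - D"
    have B: "closed B" "B \<noteq> {}"
      using False D by (auto simp: B_def)
    have "\<forall>p. \<exists>b\<in>B. infdist p B = dist p b"
      using infdist_attains_inf[OF B] by metis
    then obtain b where b: "\<And>p. b p \<in> B" "\<And>p. infdist p B = dist p (b p)" by metis
    \<comment> \<open>The criterion couples distance from 0 with distance from \<open>B\<close>: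
      zeros that meet it and are bounded stay away from \<open>B\<close>, while zeros that fail it
      and stay away from \<open>B\<close> are bounded.\<close>
    define g where "g = (\<lambda>p z. if norm p * infdist p B \<ge> 1 then - 1 / p else 1 / (z - b p))"
    have "g p holomorphic_on D" for p
    proof (cases "norm p * infdist p B \<ge> 1")
      case False
      have "(\<lambda>z. 1 / (z - b p)) holomorphic_on D"
        by (intro holomorphic_intros) (use b in \<open>auto simp: B_def\<close>)
      with False show ?thesis by (simp add: g_def)
    qed (simp add: g_def)
    moreover have "g p z \<noteq> 0" if "z \<in> D" for p z
      using that b(1)[of p] by (auto simp: g_def B_def)
    moreover have "finite {p\<in>Z. \<exists>z\<in>K. norm (1 - (z - p) * g p z) > 1 / 2}"
      if K: "compact K" "K \<subseteq> D" for K
    proof -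
      obtain R where R: "R > 0" "\<And>z. z \<in> K \<Longrightarrow> norm z \<le> R"
        using compact_imp_bounded[OF K(1)] bounded_pos by blast
      have "K \<inter> B = {}" using K(2) by (auto simp: B_def)
      then obtain \<delta> where \<delta>: "\<delta> > 0" "\<And>z y. z \<in> K \<Longrightarrow> y \<in> B \<Longrightarrow> \<delta> \<le> dist z y"
        using separate_compact_closed[OF K(1) B(1)] by metis
      \<comment> \<open>The constants come from the two kinds of factors. In the first, |p| < 2R
        forces distance at least 1/(2R) from \<open>B\<close>; in the second, distance above
        \<delta>/2 forces |p| < 2/\<delta>. The set \<open>C\<close> is compact in \<open>D\<close>
        and contains both kinds.\<close>
      define C where "C = cball 0 (max (2 * R) (2 / \<delta>)) \<inter> {p. min (1 / (2 * R)) (\<delta> / 2) \<le> infdist p B}"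
      have "closed {p. min (1 / (2 * R)) (\<delta> / 2) \<le> infdist p B}"
        by (intro closed_Collect_le continuous_intros)
      hence C: "compact C" unfolding C_def by (intro compact_Int_closed) auto
      have "C \<subseteq> D"
      proof
        fix p assume "p \<in> C"
        hence "infdist p B > 0"
          using R \<delta> by (auto simp: C_def min_def split: if_splits intro: less_le_trans[rotated])
        hence "p \<notin> B" using infdist_zero[of p B] by auto
        thus "p \<in> D" by (simp add: B_def)
      qed
      have "p \<in> C" if z: "z \<in> K" "norm (1 - (z - p) * g p z) > 1 / 2" for p z
      proof (cases "norm p * infdist p B \<ge> 1")
        case True
        hence p0: "p \<noteq> 0" by auto
        hence "1 - (z - p) * g p z = z / p" using True by (simp add: g_def field_simps)
        with z have "norm (z / p) > 1 / 2" by metis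
        with p0 have "norm p < 2 * norm z" by (simp add: norm_divide field_simps)
        hence pR: "norm p < 2 * R" using R(2)[OF z(1)] by simp
        have "1 \<le> norm p * infdist p B" by fact
        also have "\<dots> \<le> 2 * R * infdist p B"
          using pR by (intro mult_right_mono) (auto simp: infdist_nonneg)
        finally have "1 / (2 * R) \<le> infdist p B" using R(1) by (simp add: field_simps)
        with pR show ?thesis by (auto simp: C_def)
      next
        case False
        have zb: "z \<noteq> b p" using z K b(1)[of p] by (auto simp: B_def)
        hence "1 - (z - p) * g p z = (p - b p) / (z - b p)" using False by (simp add: g_def field_simps)
        with z have "norm ((p - b p) / (z - b p)) > 1 / 2" by metis
        hence "norm (z - b p) < 2 * norm (p - b p)"
          using zb by (simp add: norm_divide field_simps)
        moreover have "\<delta> \<le> norm (z - b p)"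
          using \<delta>(2)[OF z(1) b(1)[of p]] by (simp add: dist_norm)
        ultimately have d: "\<delta> / 2 < infdist p B"
          using b(2)[of p] by (simp add: dist_norm)
        have "norm p * (\<delta> / 2) \<le> norm p * infdist p B"
          using d by (intro mult_left_mono) auto
        also have "\<dots> < 1" using False by simp
        finally have "norm p < 2 / \<delta>" using \<delta>(1) by (simp add: field_simps)
        with d show ?thesis by (auto simp: C_def)
      qed
      hence "{p\<in>Z. \<exists>z\<in>K. norm (1 - (z - p) * g p z) > 1 / 2} \<subseteq> C \<inter> Z" by blast
      thus ?thesis using fin[OF C \<open>C \<subseteq> D\<close>] finite_subset by blast
    qed
    ultimately show ?thesis by blast
  qed
qed

text \<open>The zeros are discrete in \<open>D\<close>, hence countable, and can index an infinite
  product. Multiplicities enter as powers of the elementary factors, so each zero occupies a single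
  index.\<close>

theorem weierstrass_prescribed_zeros:
  fixes D :: "complex set" and d :: "complex \<Rightarrow> nat"
  assumes D: "open D" and lim: "\<And>x. x \<in> D \<Longrightarrow> \<not> x islimpt {p\<in>D. d p \<noteq> 0}"
  obtains f where "f holomorphic_on D" "\<And>p. p \<in> D \<Longrightarrow> vanishing_order f p = enat (d p)"
proof -
  define Z where "Z = {p\<in>D. d p \<noteq> 0}"
  have ZD: "Z \<subseteq> D" by (auto simp: Z_def)
  have "Z sparse_in D"
    using D lim unfolding sparse_in_def Z_def by blast
  hence "countable (D \<inter> Z)" using D sparse_imp_countable by blast
  hence cZ: "countable Z" using ZD by (simp add: Int_absorb1)
  have "\<not> x islimpt Z" if "x \<in> D" for x
    using lim[OF that] by (simp add: Z_def)
  note args = weierstrass_arguments[OF D ZD this]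
  obtain g where g: "\<And>p. p \<in> Z \<Longrightarrow> g p holomorphic_on D" "\<And>p z. p \<in> Z \<Longrightarrow> z \<in> D \<Longrightarrow> g p z \<noteq> 0"
    "\<And>K. compact K \<Longrightarrow> K \<subseteq> D \<Longrightarrow> finite {p\<in>Z. \<exists>z\<in>K. norm (1 - (z - p) * g p z) > 1 / 2}"
    using args by blast
  define idx where "idx = to_nat_on Z"
  have idx: "inj_on idx Z" unfolding idx_def by (rule inj_on_to_nat_on[OF cZ])
  define M where "M = (\<lambda>n. (1 / 2 :: real) ^ n)"
  have M: "summable M" "\<And>n. M n > 0" by (auto simp: M_def intro: summable_geometric)
  have "\<forall>n p. \<exists>k. \<forall>x. norm x \<le> 1 / 2 \<longrightarrow> norm (weierstrass_factor k x ^ d p - 1) \<le> M n"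
    using weierstrass_factor_power_near_1 M(2) by blast
  then obtain k where k: "\<And>n p x. norm x \<le> 1 / 2 \<Longrightarrow> norm (weierstrass_factor (k n p) x ^ d p - 1) \<le> M n"
    by metis
  define E where "E = (\<lambda>p z. weierstrass_factor (k (idx p) p) (1 - (z - p) * g p z) ^ d p)"
  \<comment> \<open>Unoccupied indices carry the factor 1, so finite and infinite \<open>Z\<close>
    are treated alike. The parameter \<open>A\<close> allows a zero to be left out, which is how the
    order at that zero is read off below.\<close>
  define u where "u = (\<lambda>A n. if n \<in> idx ` A then E (the_inv_into Z idx n) else (\<lambda>z. 1))"
  have u_idx: "u A (idx p) = E p" if "p \<in> A" "A \<subseteq> Z" for p A
    using that idx by (auto simp: u_def the_inv_into_f_f)
  have u_other: "u A n = (\<lambda>z. 1)" if "n \<notin> idx ` A" for n A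
    using that by (simp add: u_def)
  have E_hol: "E p holomorphic_on D" if "p \<in> Z" for p
    unfolding E_def using g(1)[OF that] by (intro holomorphic_intros)
  have E_zero: "E p z = 0 \<longleftrightarrow> z = p" if "p \<in> Z" "z \<in> D" for p z
    using that g(2)[OF that] by (auto simp: E_def Z_def)
  have u_hol: "u A n holomorphic_on D" if "A \<subseteq> Z" for A n
  proof (cases "n \<in> idx ` A")
    case True
    then obtain p where "p \<in> A" "n = idx p" by blast
    thus ?thesis using u_idx[of p A] E_hol[of p] that by auto
  qed (simp add: u_other)
  have bound: "\<forall>\<^sub>F n in sequentially. \<forall>z\<in>K. norm (u A n z - 1) \<le> M n"
    if A: "A \<subseteq> Z" and K: "compact K" "K \<subseteq> D" for A K
  proof -
    \<comment> \<open>Only finitely many zeros have an argument of modulus above 1/2 somewhere on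
      \<open>K\<close>; for the others the bound built into the choice of \<open>k\<close>
      applies.\<close>
    define bad where "bad = {p\<in>Z. \<exists>z\<in>K. norm (1 - (z - p) * g p z) > 1 / 2}"
    have "finite (idx ` bad)" using g(3)[OF K] by (simp add: bad_def)
    hence "\<forall>\<^sub>F n in sequentially. n \<notin> idx ` bad"
        using eventually_cofinite[of "\<lambda>n. n \<notin> idx ` bad"] by (simp add: cofinite_eq_sequentially)
    thus ?thesis
    proof eventually_elim
      case (elim n)
      show ?case
      proof (cases "n \<in> idx ` A")
        case True
        then obtain p where p: "p \<in> A" "n = idx p" by blast
        show ?thesis
        proof
          fix z assume "z \<in> K"
          moreover have "p \<notin> bad" "p \<in> Z" using elim p A by auto
          ultimately have "norm (1 - (z - p) * g p z) \<le> 1 / 2"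
            unfolding bad_def by force
          hence "norm (E p z - 1) \<le> M n"
            unfolding E_def p(2) by (rule k)
          thus "norm (u A n z - 1) \<le> M n"
            using u_idx[OF p(1) A] p(2) by simp
        qed
      next
        case False
        thus ?thesis using M(2)[of n] by (simp add: u_other less_imp_le)
      qed
    qed
  qed
  define P where "P = (\<lambda>A z. \<Prod>n. u A n z)"
  have P_hol: "P A holomorphic_on D" if "A \<subseteq> Z" for A
    unfolding P_def
    by (rule holomorphic_on_normally_convergent_prod[OF D u_hol[OF that] M(1) bound[OF that]])
  have P: "(\<lambda>n. u A n z) has_prod P A z" if "A \<subseteq> Z" "z \<in> D" for A z
    unfolding P_def
    by (rule has_prod_normally_convergent[OF D u_hol[OF that(1)] M(1) bound[OF that(1)] that(2)])
  have P_nz: "P A z \<noteq> 0" if A: "A \<subseteq> Z" "z \<in> D" "z \<notin> A" for A z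
  proof
    assume "P A z = 0"
    hence "0 \<in> range (\<lambda>n. u A n z)"
      using has_prod_eq_0_iff[OF P[OF A(1,2)]] by simp
    then obtain n where n: "u A n z = 0" by (metis imageE)
    have "n \<in> idx ` A"
    proof (rule ccontr)
      assume "n \<notin> idx ` A"
      with n show False by (simp add: u_other)
    qed
    then obtain p where "p \<in> A" "n = idx p" by blast
    with n u_idx[of p A] E_zero[of p z] A show False by auto
  qed
  show ?thesis
  proof (rule that)
    show "P Z holomorphic_on D" by (rule P_hol) simp
    fix p assume p: "p \<in> D"
    show "vanishing_order (P Z) p = enat (d p)"
    proof (cases "p \<in> Z")
      case False
      hence "vanishing_order (P Z) p = 0"
        using P_nz[of Z p] p P_hol[of Z] D
        by (subst vanishing_order_eq_0_iff) (auto intro: analytic_at_holomorphic_on)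
      with False p show ?thesis by (simp add: Z_def zero_enat_def)
    next
      case True
      define A where "A = Z - {p}"
      have A: "A \<subseteq> Z" "p \<notin> A" by (auto simp: A_def)
      have split: "P Z z = E p z * P A z" if z: "z \<in> D" for z
      proof -
        have "u Z n z = (if n = idx p then E p z else 1) * u A n z" for n
        proof -
          have "idx p \<notin> idx ` A" using idx True by (auto simp: A_def inj_on_def)
          moreover have "idx ` Z = insert (idx p) (idx ` A)" using True by (auto simp: A_def)
          ultimately show ?thesis
            using u_idx[of p Z] True u_other[of n A] by (auto simp: u_def)
        qed
        moreover have "(\<lambda>n. (if n = idx p then E p z else 1) * u A n z) has_prod (E p z * P A z)"
          by (intro has_prod_mult P[OF A(1) z] has_prod_single)
        ultimately have "(\<lambda>n. u Z n z) has_prod (E p z * P A z)" by simp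
        thus ?thesis using P[of Z z] z has_prod_unique2 by blast
      qed
      \<comment> \<open>One minus the argument of the elementary factor is
        \<open>(z - p) * g p z\<close>, so the \<open>d p\<close>-th power of the factor contains
        exactly (z - p)^(d p); \<open>h\<close> is what remains of the product.\<close>
      define h where "h = (\<lambda>z.
        (g p z * exp (\<Sum>j=1..k (idx p) p. (1 - (z - p) * g p z) ^ j / of_nat j)) ^ d p * P A z)"
      have "h holomorphic_on D"
        unfolding h_def using g(1)[OF True] P_hol[OF A(1)] by (intro holomorphic_intros) auto
      moreover have "h p \<noteq> 0"
        using g(2)[OF True p] P_nz[OF A(1) p A(2)] by (simp add: h_def)
      moreover have "\<forall>\<^sub>F w in nhds p. P Z w = (w - p) ^ d p * h w"
      proof -
        have "\<forall>\<^sub>F w in nhds p. w \<in> D" using D p by (rule eventually_nhds_in_open)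
        thus ?thesis
          by eventually_elim
            (simp add: split E_def h_def weierstrass_factor_def power_mult_distrib mult_ac)
      qed
      ultimately show ?thesis
        using vanishing_order_eqI D p analytic_at_holomorphic_on by blast
    qed
  qed
qed

section \<open>Division and square roots\<close>

text \<open>Near each point the common power of w - p cancels. The limit is kept as a conclusion
  because reality and sign of \<open>v\<close> at real points are later inferred from nearby
  quotients.\<close>

lemma holomorphic_quotient_same_orders:
  assumes D: "open D" and hol: "f holomorphic_on D" "g holomorphic_on D"
    and ord: "\<And>p. p \<in> D \<Longrightarrow> vanishing_order f p = vanishing_order g p"
      "\<And>p. p \<in> D \<Longrightarrow> vanishing_order g p \<noteq> \<infinity>"
  obtains v where "v holomorphic_on D" "\<And>z. z \<in> D \<Longrightarrow> v z \<noteq> 0" "\<And>z. z \<in> D \<Longrightarrow> f z = g z * v z"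
    "\<And>z. z \<in> D \<Longrightarrow> (\<lambda>w. f w / g w) \<midarrow>z\<rightarrow> v z"
proof -
  \<comment> \<open>Being a limit of one global quotient, \<open>v\<close> agrees with every local
    quotient, so nothing has to be glued.\<close>
  define v where "v = (\<lambda>z. Lim (at z) (\<lambda>w. f w / g w))"
  have local: "\<exists>S h. open S \<and> p \<in> S \<and> h holomorphic_on S \<and>
      (\<forall>w\<in>S. h w \<noteq> 0 \<and> f w = g w * h w \<and> v w = h w \<and> (\<lambda>w. f w / g w) \<midarrow>w\<rightarrow> h w)"
    if p: "p \<in> D" for p
  proof -
    obtain k where k: "vanishing_order g p = enat k" "vanishing_order f p = enat k"
      using ord[OF p] by auto
    obtain f1 where f1: "f1 analytic_on {p}" "f1 p \<noteq> 0" "\<forall>\<^sub>F w in nhds p. f w = (w - p) ^ k * f1 w"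
      using vanishing_order_eqE[OF analytic_at_holomorphic_on[OF hol(1) D p] k(2)] .
    obtain g1 where g1: "g1 analytic_on {p}" "g1 p \<noteq> 0" "\<forall>\<^sub>F w in nhds p. g w = (w - p) ^ k * g1 w"
      using vanishing_order_eqE[OF analytic_at_holomorphic_on[OF hol(2) D p] k(1)] .
    define h where "h = (\<lambda>w. f1 w / g1 w)"
    have "h analytic_on {p}"
      unfolding h_def by (intro analytic_intros f1 g1) (use g1 in auto)
    then obtain T where T: "open T" "p \<in> T" "h holomorphic_on T"
      using analytic_at by blast
    have nz: "\<forall>\<^sub>F w in nhds p. \<phi> w \<noteq> 0" if "\<phi> analytic_on {p}" "\<phi> p \<noteq> (0::complex)" for \<phi>
      using eventually_at_nonzero[OF that] that(2) by (auto simp: eventually_at_filter elim!: eventually_mono)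
    have "\<forall>\<^sub>F w in nhds p. f w = (w - p) ^ k * f1 w \<and> g w = (w - p) ^ k * g1 w \<and> f1 w \<noteq> 0 \<and> g1 w \<noteq> 0"
      using f1(3) g1(3) nz[OF f1(1,2)] nz[OF g1(1,2)] by eventually_elim auto
    then obtain U where U: "open U" "p \<in> U" "\<And>w. w \<in> U \<Longrightarrow>
        f w = (w - p) ^ k * f1 w \<and> g w = (w - p) ^ k * g1 w \<and> f1 w \<noteq> 0 \<and> g1 w \<noteq> 0"
      unfolding eventually_nhds by metis
    define S where "S = T \<inter> U"
    have S: "open S" "p \<in> S" "h holomorphic_on S"
      using T U unfolding S_def by (auto intro: holomorphic_on_subset)
    have lim: "(\<lambda>w. f w / g w) \<midarrow>w\<rightarrow> h w" if w: "w \<in> S" for w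
    proof -
      have "isCont h w"
        using S(1,3) w continuous_on_eq_continuous_at holomorphic_on_imp_continuous_on by blast
      hence "h \<midarrow>w\<rightarrow> h w" by (simp add: isCont_def)
      moreover have "\<forall>\<^sub>F x in at w. h x = f x / g x"
      proof -
        have "\<forall>\<^sub>F x in at w. x \<in> S" using S(1) w by (rule eventually_at_in_open')
        \<comment> \<open>At \<open>p\<close> the quotient may be 0 / 0, which is 0 by convention,
          and has to be excluded.\<close>
        moreover have "\<forall>\<^sub>F x in at w. x \<noteq> p" by (rule eventually_neq_at_within)
        ultimately show ?thesis
        proof eventually_elim
          case (elim x)
          have "x \<in> U" using elim by (simp add: S_def)
          from U(3)[OF this] elim show ?case by (simp add: h_def)
        qed
      qed
      ultimately show ?thesis by (rule Lim_transform_eventually)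
    qed
    have "\<forall>w\<in>S. h w \<noteq> 0 \<and> f w = g w * h w \<and> v w = h w \<and> (\<lambda>w. f w / g w) \<midarrow>w\<rightarrow> h w"
    proof
      fix w assume w: "w \<in> S"
      have "v w = h w" unfolding v_def by (rule tendsto_Lim[OF _ lim[OF w]]) simp
      moreover have "w \<in> U" using w by (simp add: S_def)
      ultimately show "h w \<noteq> 0 \<and> f w = g w * h w \<and> v w = h w \<and> (\<lambda>w. f w / g w) \<midarrow>w\<rightarrow> h w"
        using U(3)[of w] lim[OF w] by (simp add: h_def)
    qed
    with S show ?thesis by blast
  qed
  show ?thesis
  proof (rule that)
    show "v holomorphic_on D"
    proof (rule analytic_imp_holomorphic, subst analytic_on_analytic_at, rule ballI)
      fix p assume "p \<in> D"
      then obtain S h where S: "open S" "p \<in> S" "h holomorphic_on S" "\<forall>w\<in>S. v w = h w"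
        using local[of p] by blast
      hence "v holomorphic_on S" by (metis holomorphic_transform)
      thus "v analytic_on {p}" using S analytic_at by blast
    qed
    show "v z \<noteq> 0" "f z = g z * v z" "(\<lambda>w. f w / g w) \<midarrow>z\<rightarrow> v z" if "z \<in> D" for z
      using local[OF that] by metis+
  qed
qed

text \<open>This makes limits from the upper half unique at real points of \<open>D\<close>, and
  lets a germ of zeros at such a point be moved into the open upper half.\<close>

lemma islimpt_upper_half:
  assumes "open D" "z \<in> D" "Im z \<ge> 0"
  shows "z islimpt (D \<inter> {z. 0 < Im z})"
  unfolding islimpt_approachable
proof safe
  fix e :: real assume "e > 0"
  obtain r where r: "r > 0" "ball z r \<subseteq> D"
    using assms open_contains_ball by blast
  define y where "y = z + \<i> * of_real (min e r / 2)"
  have m: "0 < min e r" "min e r \<le> e" "min e r \<le> r" using \<open>e > 0\<close> r(1) by auto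
  have "dist y z = min e r / 2"
    using m by (simp add: y_def dist_norm norm_mult)
  moreover from this have "y \<in> D" using r m by (auto simp: dist_commute)
  moreover have "0 < Im y"
    using add_nonneg_pos[OF assms(3), of "min e r / 2"] m(1) by (simp add: y_def)
  ultimately show "\<exists>x'\<in>D \<inter> {z. 0 < Im z}. x' \<noteq> z \<and> dist x' z < e"
    using m by (intro bexI[of _ y]) (auto simp: y_def)
qed

text \<open>\<open>D\<close> may be disconnected, so analytic continuation works only inside the
  upper half. Symmetry moves the germ there and carries the result to the lower half; real points
  are reached by continuity.\<close>

lemma real_holomorphic_zero_propagates:
  assumes D: "open D" "cnj ` D = D" "connected (D \<inter> {z. 0 < Im z})"
    and f: "f holomorphic_on D" "\<And>z. z \<in> D \<Longrightarrow> f (cnj z) = cnj (f z)"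
    and p: "p \<in> D" "\<forall>\<^sub>F w in nhds p. f w = 0" and z: "z \<in> D"
  shows "f z = 0"
proof -
  let ?U = "D \<inter> {z. 0 < Im z}"
  have cnjD: "cnj z \<in> D" if "z \<in> D" for z using D(2) that by blast
  have U: "open ?U" using D(1) by (intro open_Int open_halfspace_Im_gt)
  have start: "\<exists>q\<in>?U. \<forall>\<^sub>F w in nhds q. f w = 0"
    if p: "p \<in> D" "\<forall>\<^sub>F w in nhds p. f w = 0" "Im p \<ge> 0" for p
  proof -
    obtain S where S: "open S" "p \<in> S" "\<And>w. w \<in> S \<Longrightarrow> f w = 0"
      using p(2) unfolding eventually_nhds by blast
    have "p islimpt (D \<inter> S) \<inter> {z. 0 < Im z}"
      using S D(1) p by (intro islimpt_upper_half) auto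
    then obtain q where "q \<in> (D \<inter> S) \<inter> {z. 0 < Im z}"
      by (metis ex_in_conv islimpt_EMPTY)
    thus ?thesis using S by (intro bexI[of _ q]) (auto simp: eventually_nhds)
  qed
  have "\<exists>q\<in>?U. \<forall>\<^sub>F w in nhds q. f w = 0"
  proof (cases "Im p \<ge> 0")
    case True
    thus ?thesis using start p by blast
  next
    case False
    have "\<forall>\<^sub>F w in nhds p. w \<in> D" using D(1) p(1) by (rule eventually_nhds_in_open)
    with p(2) have "\<forall>\<^sub>F w in nhds p. f (cnj w) = 0" by eventually_elim (simp add: f(2))
    hence "\<forall>\<^sub>F w in nhds (cnj p). f w = 0" by (subst eventually_nhds_cnj_iff)
    thus ?thesis using start[of "cnj p"] False p(1) cnjD by auto
  qed
  then obtain q where q: "q \<in> ?U" "\<forall>\<^sub>F w in nhds q. f w = 0" by blast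
  obtain S where S: "open S" "q \<in> S" "\<And>w. w \<in> S \<Longrightarrow> f w = 0"
    using q(2) unfolding eventually_nhds by blast
  have upper: "f z = 0" if "z \<in> ?U" for z
  proof (rule analytic_continuation[of f ?U "S \<inter> ?U" q])
    show "f holomorphic_on ?U" using f(1) holomorphic_on_subset by blast
    show "q islimpt S \<inter> ?U" using S U q(1) by (intro open_imp_islimpt) auto
  qed (use U D(3) S q that in auto)
  consider "Im z > 0" | "Im z < 0" | "Im z = 0" by linarith
  thus ?thesis
  proof cases
    case 1
    thus ?thesis using upper z by blast
  next
    case 2
    hence "f (cnj z) = 0" using upper[of "cnj z"] cnjD[OF z] by simp
    thus ?thesis using f(2)[OF z] by simp
  next
    case 3
    have "at z within ?U \<noteq> bot"
      using islimpt_upper_half[OF D(1) z] 3 by (simp add: trivial_limit_within)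
    moreover have "(f \<longlongrightarrow> f z) (at z within ?U)"
    proof -
      have "isCont f z"
        using f(1) D(1) z continuous_on_eq_continuous_at holomorphic_on_imp_continuous_on by blast
      thus ?thesis by (simp add: continuous_at_imp_continuous_at_within flip: continuous_within)
    qed
    moreover have "(f \<longlongrightarrow> 0) (at z within ?U)"
      by (rule tendsto_eventually) (use upper in \<open>auto simp: eventually_at_filter\<close>)
    ultimately show ?thesis by (metis tendsto_unique)
  qed
qed

text \<open>\<open>D\<close> itself need not be simply connected, as in $\mathbb C\setminus[0,1]$; but each branch on the
  upper half is real on the real points, so the Schwarz reflection of a branch is single-valued.\<close>

lemma real_holomorphic_sqrt:
  assumes D: "open D" "cnj ` D = D" "simply_connected (D \<inter> {z. 0 < Im z})"
    and v: "v holomorphic_on D" "\<And>z. z \<in> D \<Longrightarrow> v z \<noteq> 0"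
      "\<And>z. z \<in> D \<Longrightarrow> z \<in> \<real> \<Longrightarrow> v z \<in> \<real> \<and> Re (v z) > 0"
  obtains w where "w holomorphic_on D" "\<And>z. w (cnj z) = cnj (w z)"
    "\<And>z. z \<in> D \<Longrightarrow> Im z \<ge> 0 \<Longrightarrow> w z ^ 2 = v z"
proof -
  let ?U = "D \<inter> {z. 0 < Im z}" and ?T = "D \<inter> {z. 0 \<le> Im z}"
  have U: "open ?U" using D(1) by (intro open_Int open_halfspace_Im_gt)
  have "v holomorphic_on ?U" using v(1) holomorphic_on_subset by blast
  then obtain s where s: "s holomorphic_on ?U" "\<And>z. z \<in> ?U \<Longrightarrow> v z = s z ^ 2"
    using D(3) v(2) unfolding simply_connected_eq_holomorphic_sqrt[OF U] by (metis IntD1)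
  \<comment> \<open>At real points of \<open>D\<close> the branch is extended by its limit from
    above. The default 0 keeps \<open>f\<close> real at real points outside \<open>D\<close>, so
    that the symmetry of \<open>w\<close> below holds without restriction.\<close>
  define f where "f = (\<lambda>z. if Im z > 0 then s z else if Im z = 0 \<and> z \<in> D then Lim (at z within ?U) s else 0)"
  \<comment> \<open>Near a real point \<open>v\<close> has positive real part and avoids the cut of
    \<open>csqrt\<close>. The principal root is therefore continuous across the axis, and the chosen
    branch equals it up to one fixed sign.\<close>
  have local: "\<exists>r>0. \<exists>c\<in>{1,-1}. continuous_on (ball x r) (\<lambda>z. c * csqrt (v z)) \<and>
      (\<forall>z\<in>ball x r. 0 \<le> Im z \<longrightarrow> f z = c * csqrt (v z))"
    if x: "x \<in> D" "Im x = 0" for x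
  proof -
    have "x \<in> \<real>" using x by (simp add: complex_is_Real_iff)
    define W where "W = D \<inter> (\<lambda>z. Re (v z)) -` {0<..}"
    have "continuous_on D (\<lambda>z. Re (v z))"
      by (intro continuous_intros holomorphic_on_imp_continuous_on v)
    hence "open W" unfolding W_def
      by (subst (asm) continuous_on_open_vimage[OF D(1)]) (auto simp: Int_commute)
    moreover have "x \<in> W" using x v(3)[OF x(1)] \<open>x \<in> \<real>\<close> by (simp add: W_def)
    ultimately obtain r where r: "r > 0" "ball x r \<subseteq> W" using open_contains_ball by blast
    have cs: "continuous_on (ball x r) (\<lambda>z. csqrt (v z))"
    proof (intro holomorphic_on_imp_continuous_on holomorphic_on_csqrt')
      show "v holomorphic_on ball x r"
        using v(1) r(2) holomorphic_on_subset by (auto simp: W_def)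
      show "v z \<notin> \<real>\<^sub>\<le>\<^sub>0" if "z \<in> ball x r" for z
        using r(2) that by (auto simp: W_def complex_nonpos_Reals_iff)
    qed
    have nz: "csqrt (v z) \<noteq> 0" if "z \<in> ball x r" for z
      using r(2) that v(2) by (auto simp: W_def)
    define B where "B = ball x r \<inter> {z. 0 < Im z}"
    have BU: "B \<subseteq> ?U" using r(2) by (auto simp: B_def W_def)
    \<comment> \<open>The quotient of two square roots of \<open>v\<close> has values 1 and -1,
      hence is constant on the connected half disc.\<close>
    define q where "q = (\<lambda>z. s z / csqrt (v z))"
    have q2: "q z \<in> {1, -1}" if "z \<in> B" for z
    proof -
      have "q z ^ 2 = v z / v z"
        using s(2)[of z] subsetD[OF BU that] by (simp add: q_def power_divide)
      also have "\<dots> = 1" using v(2)[of z] BU that by auto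
      finally show ?thesis by (simp add: power2_eq_1_iff)
    qed
    have "q constant_on B"
    proof (rule continuous_finite_range_constant)
      show "connected B"
        unfolding B_def by (intro convex_connected convex_Int convex_ball convex_halfspace_Im_gt)
      show "continuous_on B q" unfolding q_def
        by (intro continuous_intros continuous_on_subset[OF cs]
              continuous_on_subset[OF holomorphic_on_imp_continuous_on[OF s(1)]] BU)
           (use nz in \<open>auto simp: B_def\<close>)
      show "finite (q ` B)" by (rule finite_subset[of _ "{1,-1}"]) (use q2 in auto)
    qed
    then obtain c where c: "\<And>z. z \<in> B \<Longrightarrow> q z = c" unfolding constant_on_def by blast
    have "x islimpt B" unfolding B_def using r(1) x by (intro islimpt_upper_half) auto
    then obtain b where "b \<in> B" by (metis ex_in_conv islimpt_EMPTY)
    hence c1: "c \<in> {1,-1}" using q2 c by blast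
    have sB: "s z = c * csqrt (v z)" if "z \<in> B" for z
      using c[OF that] nz[of z] that by (auto simp: q_def B_def divide_eq_eq)
    have "f z = c * csqrt (v z)" if z: "z \<in> ball x r" "0 \<le> Im z" for z
    proof (cases "Im z = 0")
      case False
      thus ?thesis using sB[of z] z by (simp add: f_def B_def)
    next
      case True
      have zD: "z \<in> D" using z r(2) by (auto simp: W_def)
      have "continuous_on (ball x r) (\<lambda>z. c * csqrt (v z))"
        by (intro continuous_intros cs)
      hence "isCont (\<lambda>z. c * csqrt (v z)) z"
        using z(1) continuous_on_eq_continuous_at[OF open_ball] by blast
      hence "((\<lambda>z. c * csqrt (v z)) \<longlongrightarrow> c * csqrt (v z)) (at z within ?U)"
        using continuous_at_imp_continuous_at_within continuous_within by blast
      moreover have "\<forall>\<^sub>F y in at z within ?U. c * csqrt (v y) = s y"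
      proof -
        have "\<forall>\<^sub>F y in at z within ?U. y \<in> ball x r"
          using eventually_nhds_in_open[OF open_ball z(1)]
          by (auto simp: eventually_at_filter elim: eventually_mono)
        moreover have "\<forall>\<^sub>F y in at z within ?U. y \<in> ?U" by (auto simp: eventually_at_filter)
        ultimately show ?thesis by eventually_elim (simp add: sB B_def)
      qed
      ultimately have "(s \<longlongrightarrow> c * csqrt (v z)) (at z within ?U)"
        by (rule Lim_transform_eventually)
      moreover have "at z within ?U \<noteq> bot"
        using islimpt_upper_half[OF D(1) zD] True by (simp add: trivial_limit_within)
      ultimately show ?thesis using True zD by (simp add: f_def tendsto_Lim)
    qed
    with r(1) c1 cs show ?thesis by (intro exI[of _ r] conjI bexI[of _ c]) (auto intro!: continuous_intros)
  qed
  have contf: "continuous_on ?T f"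
    unfolding continuous_on_eq_continuous_within
  proof
    fix x assume x: "x \<in> ?T"
    show "continuous (at x within ?T) f"
    proof (cases "Im x = 0")
      case True
      then obtain r c where rc: "r > 0" "continuous_on (ball x r) (\<lambda>z. c * csqrt (v z))"
          "\<forall>z\<in>ball x r. 0 \<le> Im z \<longrightarrow> f z = c * csqrt (v z)"
        using local[of x] x by blast
      have "isCont (\<lambda>z. c * csqrt (v z)) x"
        using rc(1,2) continuous_on_eq_continuous_at[OF open_ball] centre_in_ball by blast
      hence "continuous (at x within ?T) (\<lambda>z. c * csqrt (v z))"
        by (rule continuous_at_imp_continuous_at_within)
      thus ?thesis
        by (rule continuous_transform_within[OF _ rc(1) x]) (use rc(3) in \<open>auto simp: dist_commute\<close>)
    next
      case False
      hence xU: "x \<in> ?U" using x by auto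
      then obtain r where r: "r > 0" "ball x r \<subseteq> ?U" using U open_contains_ball by blast
      have "isCont s x"
        using s(1) U xU continuous_on_eq_continuous_at holomorphic_on_imp_continuous_on by blast
      hence "continuous (at x within ?T) s" by (rule continuous_at_imp_continuous_at_within)
      thus ?thesis
      proof (rule continuous_transform_within[OF _ r(1) x])
        fix y assume "dist y x < r"
        hence "y \<in> ?U" by (intro subsetD[OF r(2)]) (simp add: dist_commute)
        thus "s y = f y" by (simp add: f_def)
      qed
    qed
  qed
  \<comment> \<open>Real boundary values are the hypothesis of Schwarz reflection; they come from
    positivity of \<open>v\<close>.\<close>
  have realf: "f z \<in> \<real> \<and> f z ^ 2 = v z" if z: "z \<in> D" "z \<in> \<real>" for z
  proof -
    have "Im z = 0" using z by (simp add: complex_is_Real_iff)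
    then obtain r c where rc: "r > 0" "c \<in> {1,-1}" "\<forall>z\<in>ball z r. 0 \<le> Im z \<longrightarrow> f z = c * csqrt (v z)"
      using local[OF z(1)] by blast
    hence fz: "f z = c * csqrt (v z)" using \<open>Im z = 0\<close> by simp
    obtain t where t: "v z = of_real t" "t > 0"
      using v(3)[OF z] by (auto elim!: Reals_cases)
    have "csqrt (v z) = of_real (sqrt t)"
      using t by (simp add: csqrt_of_real_nonneg)
    with fz rc(2) t show ?thesis by (auto simp: power_mult_distrib simp flip: of_real_power)
  qed
  define w where "w = (\<lambda>z. if 0 \<le> Im z then f z else cnj (f (cnj z)))"
  show ?thesis
  proof (rule that)
    show "w holomorphic_on D"
      unfolding w_def
    proof (rule Schwarz_reflection[OF D(1) _ _ contf])
      show "f holomorphic_on ?U"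
        using s(1) by (rule holomorphic_transform) (simp add: f_def)
    qed (use D(2) realf in auto)
    show "w (cnj z) = cnj (w z)" for z
    proof (cases "Im z = 0")
      case True
      hence "cnj z = z" by (simp add: complex_eq_iff)
      moreover have "w z \<in> \<real>"
        using True realf[of z] by (cases "z \<in> D") (auto simp: w_def complex_is_Real_iff f_def)
      ultimately show ?thesis by (simp add: Reals_cnj_iff)
    next
      case False
      thus ?thesis by (auto simp: w_def)
    qed
    \<comment> \<open>Below the axis \<open>w\<close> is a root of the reflection of
      \<open>v\<close>, and no symmetry of \<open>v\<close> is assumed here; hence the restriction
      to the closed upper half.\<close>
    show "w z ^ 2 = v z" if "z \<in> D" "Im z \<ge> 0" for z
    proof (cases "Im z = 0")
      case True
      thus ?thesis using realf[of z] that by (auto simp: w_def complex_is_Real_iff)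
    next
      case False
      thus ?thesis using s(2)[of z] that by (simp add: w_def f_def)
    qed
  qed
qed

section \<open>Factoring a sum of squares of real functions\<close>

lemma vanishing_order_cnj:
  assumes "open D" "cnj ` D = D" "f holomorphic_on D" "\<And>z. z \<in> D \<Longrightarrow> f (cnj z) = cnj (f z)" "p \<in> D"
  shows "vanishing_order f (cnj p) = vanishing_order f p"
proof -
  have "cnj p \<in> D" using assms(2,5) by blast
  hence "vanishing_order (cnj_reflect f) p = vanishing_order f (cnj p)"
    by (intro vanishing_order_cnj_reflect analytic_at_holomorphic_on[OF assms(3,1)])
  moreover have "vanishing_order (cnj_reflect f) p = vanishing_order f p"
  proof (rule vanishing_order_cong)
    have "\<forall>\<^sub>F w in nhds p. w \<in> D" using assms(1,5) by (rule eventually_nhds_in_open)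
    thus "\<forall>\<^sub>F w in nhds p. cnj_reflect f w = f w"
      by eventually_elim (simp add: cnj_reflect_def assms(4))
  qed
  ultimately show ?thesis by simp
qed

lemma at_within_Reals_neq_bot:
  assumes "z \<in> \<real>"
  shows "at (z::complex) within \<real> \<noteq> bot"
proof -
  have "z islimpt \<real>"
    unfolding islimpt_approachable
  proof safe
    fix e :: real assume "e > 0"
    thus "\<exists>x'\<in>\<real>. x' \<noteq> z \<and> dist x' z < e"
      using assms by (intro bexI[of _ "z + of_real (e / 2)"]) (auto simp: dist_norm)
  qed
  thus ?thesis by (simp add: trivial_limit_within)
qed

text \<open>If all quotients vanished at \<open>p\<close>, the component attaining the minimum would
  have order at least m + 1.\<close>

lemma common_vanishing_factor:
  assumes L: "finite L" "L \<noteq> {}" and F: "\<And>l. l \<in> L \<Longrightarrow> F l analytic_on {p}"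
    and m: "Min ((\<lambda>l. vanishing_order (F l) p) ` L) = enat m"
  obtains G where "\<And>l. l \<in> L \<Longrightarrow> G l analytic_on {p}"
    "\<And>l. l \<in> L \<Longrightarrow> \<forall>\<^sub>F w in nhds p. F l w = (w - p) ^ m * G l w" "\<exists>l\<in>L. G l p \<noteq> 0"
proof -
  have "\<exists>g. g analytic_on {p} \<and> (\<forall>\<^sub>F w in nhds p. F l w = (w - p) ^ m * g w)" if "l \<in> L" for l
  proof -
    have "enat m \<le> vanishing_order (F l) p"
      using L that by (simp flip: m)
    thus ?thesis using enat_le_vanishing_order_iff[OF F[OF that]] by blast
  qed
  then obtain G where G: "\<And>l. l \<in> L \<Longrightarrow> G l analytic_on {p}"
      "\<And>l. l \<in> L \<Longrightarrow> \<forall>\<^sub>F w in nhds p. F l w = (w - p) ^ m * G l w"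
    by metis
  have "enat m \<in> (\<lambda>l. vanishing_order (F l) p) ` L"
    unfolding m[symmetric] using L by (intro Min_in) auto
  then obtain l where l: "l \<in> L" "vanishing_order (F l) p = enat m" by auto
  have "G l p \<noteq> 0"
  proof
    assume "G l p = 0"
    hence "vanishing_order (G l) p \<noteq> 0"
      using vanishing_order_eq_0_iff[OF G(1)[OF l(1)]] by simp
    hence "enat 1 \<le> vanishing_order (G l) p"
      by (metis ileI1 one_eSuc one_enat_def zero_enat_def not_gr_zero)
    then obtain g where g: "g analytic_on {p}" "\<forall>\<^sub>F w in nhds p. G l w = (w - p) ^ 1 * g w"
      using enat_le_vanishing_order_iff[OF G(1)[OF l(1)]] by blast
    have "\<forall>\<^sub>F w in nhds p. F l w = (w - p) ^ Suc m * g w"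
      using G(2)[OF l(1)] g(2) by eventually_elim simp
    hence "enat (Suc m) \<le> vanishing_order (F l) p"
      using enat_le_vanishing_order_iff[OF F[OF l(1)]] g(1) by blast
    with l(2) show False by simp
  qed
  with l(1) have "\<exists>l\<in>L. G l p \<noteq> 0" by blast
  show ?thesis by (rule that[of G]) fact+
qed

lemma real_factorization_of_sum_of_squares:
  fixes F :: "'i \<Rightarrow> complex \<Rightarrow> complex"
  assumes L: "finite L" "L \<noteq> {}"
    and D: "open D" "cnj ` D = D" "simply_connected (D \<inter> {z. 0 < Im z})"
    and F: "\<And>l. l \<in> L \<Longrightarrow> F l holomorphic_on D"
      "\<And>l z. l \<in> L \<Longrightarrow> z \<in> D \<Longrightarrow> F l (cnj z) = cnj (F l z)"
  obtains h where "h holomorphic_on D"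
    "\<And>z. z \<in> D \<Longrightarrow> h z * cnj_reflect h z = (\<Sum>l\<in>L. F l z ^ 2)"
    "\<And>p. p \<in> D \<Longrightarrow> min (vanishing_order h p) (vanishing_order (cnj_reflect h) p)
        = Min ((\<lambda>l. vanishing_order (F l) p) ` L)"
proof -
  note result = that
  define N where "N = (\<lambda>z. \<Sum>l\<in>L. F l z ^ 2)"
  define mm where "mm = (\<lambda>p. Min ((\<lambda>l. vanishing_order (F l) p) ` L))"
  have cnjD: "cnj z \<in> D" if "z \<in> D" for z using D(2) that by blast
  have conn: "connected (D \<inter> {z. 0 < Im z})" by (rule simply_connected_imp_connected[OF D(3)])
  note ana = analytic_at_holomorphic_on[OF _ D(1)]
  have inD: "\<forall>\<^sub>F w in nhds p. w \<in> D" if "p \<in> D" for p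
    using D(1) that by (rule eventually_nhds_in_open)
  have N_hol: "N holomorphic_on D" unfolding N_def by (intro holomorphic_intros F)
  have N_cnj: "N (cnj z) = cnj (N z)" if "z \<in> D" for z
    using that by (simp add: N_def F(2))
  have mm_cnj: "mm (cnj p) = mm p" if "p \<in> D" for p
    using vanishing_order_cnj[OF D(1,2) F that] by (simp add: mm_def)
  \<comment> \<open>Taking (w - p)^m out of every component leaves a sum \<open>H\<close> of
    squares. At a nonreal point these may cancel; at a real point they are squares of real numbers,
    not all zero.\<close>
  have N_factor: "\<exists>H. H analytic_on {p} \<and> (\<forall>\<^sub>F w in nhds p. N w = (w - p) ^ (2 * m) * H w) \<and> (p \<in> \<real> \<longrightarrow> H p \<noteq> 0)"
    if p: "p \<in> D" "mm p = enat m" for p m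
  proof -
    obtain G where G: "\<And>l. l \<in> L \<Longrightarrow> G l analytic_on {p}"
      "\<And>l. l \<in> L \<Longrightarrow> \<forall>\<^sub>F w in nhds p. F l w = (w - p) ^ m * G l w" "\<exists>l\<in>L. G l p \<noteq> 0"
      using common_vanishing_factor[OF L ana[OF F(1) p(1)] p(2)[unfolded mm_def]] by blast
    define H where "H = (\<lambda>w. \<Sum>l\<in>L. G l w ^ 2)"
    have "H analytic_on {p}" unfolding H_def by (intro analytic_intros G)
    moreover have "\<forall>\<^sub>F w in nhds p. N w = (w - p) ^ (2 * m) * H w"
    proof -
      have "\<forall>\<^sub>F w in nhds p. \<forall>l\<in>L. F l w = (w - p) ^ m * G l w"
        using G(2) L(1) by (simp add: eventually_ball_finite)
      thus ?thesis
        by eventually_elim (simp add: N_def H_def sum_distrib_left power_mult_distrib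
              power_mult[of _ m 2] mult.commute[of 2 m])
    qed
    moreover have "H p \<noteq> 0" if real: "p \<in> \<real>"
    proof -
      \<comment> \<open>Along the real axis \<open>G l\<close> is a quotient of real numbers, and
        the reals are closed under limits.\<close>
      have Greal: "G l p \<in> \<real>" if l: "l \<in> L" for l
      proof -
        have "at p within \<real> \<noteq> bot" by (rule at_within_Reals_neq_bot) fact
        moreover have "\<forall>\<^sub>F w in at p within \<real>. G l w \<in> \<real>"
          unfolding eventually_at_filter
          using G(2)[OF l] inD[OF p(1)]
        proof eventually_elim
          case (elim w)
          show ?case
          proof (intro impI)
            assume w: "w \<noteq> p" "w \<in> \<real>"
            have "F l w \<in> \<real>" using F(2)[OF l elim(2)] w(2) by (simp add: Reals_cnj_iff)
            moreover have "G l w = F l w / (w - p) ^ m" using elim(1) w(1) by simp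
            ultimately show "G l w \<in> \<real>" using w(2) real by simp
          qed
        qed
        moreover have "(G l \<longlongrightarrow> G l p) (at p within \<real>)"
          using analytic_at_imp_isCont[OF G(1)[OF l]] continuous_at_imp_continuous_at_within
            continuous_within by blast
        ultimately show ?thesis
          using Lim_in_closed_set[OF closed_complex_Reals] by blast
      qed
      have "Re (H p) = (\<Sum>l\<in>L. (Re (G l p))\<^sup>2)"
        unfolding H_def using Greal by (auto simp: complex_is_Real_iff power2_eq_square intro!: sum.cong)
      also have "\<dots> > 0"
      proof -
        obtain l where l: "l \<in> L" "G l p \<noteq> 0" using G(3) by blast
        hence "Re (G l p) \<noteq> 0" using Greal[of l] by (auto simp: complex_is_Real_iff complex_eq_iff)
        thus ?thesis using L(1) l(1) by (intro sum_pos2[of L l]) auto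
      qed
      finally show ?thesis by auto
    qed
    ultimately show ?thesis by blast
  qed
  have N_ge: "enat (2 * m) \<le> vanishing_order N p" if "p \<in> D" "mm p = enat m" for p m
    using N_factor[OF that] enat_le_vanishing_order_iff[OF ana[OF N_hol that(1)]] by blast
  have N_real: "vanishing_order N p = enat (2 * m)" if "p \<in> D" "mm p = enat m" "p \<in> \<real>" for p m
    using N_factor[OF that(1,2)] vanishing_order_eqI that(3) by blast
  \<comment> \<open>Passing from p to its conjugate exchanges the orders of \<open>h\<close> and
    \<open>cnj_reflect h\<close>, so the minimum needs checking only on the closed upper
    half.\<close>
  have h_goal: thesis
    if h: "h holomorphic_on D" "\<And>z. z \<in> D \<Longrightarrow> h z * cnj_reflect h z = N z"
      "\<And>p. p \<in> D \<Longrightarrow> 0 \<le> Im p \<Longrightarrow> min (vanishing_order h p) (vanishing_order (cnj_reflect h) p) = mm p" for h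
  proof (rule result)
    show "h holomorphic_on D" by fact
    show "h z * cnj_reflect h z = (\<Sum>l\<in>L. F l z ^ 2)" if "z \<in> D" for z
      using h(2)[OF that] by (simp add: N_def)
    fix p assume p: "p \<in> D"
    have "min (vanishing_order h p) (vanishing_order (cnj_reflect h) p) = mm p"
    proof (cases "0 \<le> Im p")
      case False
      have 1: "vanishing_order (cnj_reflect h) (cnj p) = vanishing_order h p"
        using vanishing_order_cnj_reflect[of h "cnj p"] ana[OF h(1) p] by simp
      have 2: "vanishing_order (cnj_reflect h) p = vanishing_order h (cnj p)"
        using vanishing_order_cnj_reflect[of h p] ana[OF h(1) cnjD[OF p]] by simp
      show ?thesis
        using h(3)[OF cnjD[OF p]] False by (simp add: 1 2 mm_cnj[OF p] min.commute)
    qed (use h(3) p in blast)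
    thus "min (vanishing_order h p) (vanishing_order (cnj_reflect h) p)
        = Min ((\<lambda>l. vanishing_order (F l) p) ` L)" by (simp add: mm_def)
  qed
  have F_nonzero_order: "mm p \<noteq> \<infinity>" if "p \<in> D" "l \<in> L" "\<not> (\<forall>z\<in>D. F l z = 0)" for l p
  proof
    assume "mm p = \<infinity>"
    hence "vanishing_order (F l) p = \<infinity>"
      using L that(2) by (simp add: mm_def) (metis (no_types, lifting) Min_le enat_ord_simps(5) finite_imageI image_eqI)
    thus False
      using real_holomorphic_zero_propagates[OF D(1,2) conn F[OF that(2)] that(1)] that(3)
      by (simp add: vanishing_order_eq_infinity_iff)
  qed
  have zeros_isolated: "\<forall>\<^sub>F w in at x. f w \<noteq> 0" if f: "f analytic_on {x}" "vanishing_order f x \<noteq> \<infinity>" for f x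
  proof -
    obtain k where "vanishing_order f x = enat k" using f(2) by auto
    then obtain g where g: "g analytic_on {x}" "g x \<noteq> 0" "\<forall>\<^sub>F w in nhds x. f w = (w - x) ^ k * g w"
      using vanishing_order_eqE[OF f(1)] by metis
    show ?thesis
      using eventually_at_nonzero[OF g(1,2)] g(3) unfolding eventually_at_filter by eventually_elim auto
  qed
  \<comment> \<open>Orders can be prescribed once they are supported on zeros of a function of
    finite order at each point, because such zeros are isolated.\<close>
  have limpt: "\<not> x islimpt {p\<in>D. d p \<noteq> (0::nat)}"
    if "x \<in> D" "f holomorphic_on D" "vanishing_order f x \<noteq> \<infinity>" "\<And>p. p \<in> D \<Longrightarrow> d p \<noteq> 0 \<Longrightarrow> f p = 0" for x f d
  proof -
    have "\<forall>\<^sub>F w in at x. w \<notin> {p\<in>D. d p \<noteq> 0}"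
      using zeros_isolated[OF ana[OF that(2,1)] that(3)] by eventually_elim (use that(4) in blast)
    thus ?thesis by (simp add: islimpt_iff_eventually)
  qed
  show ?thesis
  proof (cases "\<exists>p\<in>D. vanishing_order N p = \<infinity>")
    case True
    then obtain p0 where p0: "p0 \<in> D" "\<forall>\<^sub>F w in nhds p0. N w = 0"
      by (auto simp: vanishing_order_eq_infinity_iff)
    have N0: "N z = 0" if "z \<in> D" for z
      using real_holomorphic_zero_propagates[OF D(1,2) conn N_hol N_cnj p0 that] .
    show ?thesis
    proof (cases "\<forall>l\<in>L. \<forall>z\<in>D. F l z = 0")
      case True
      have "vanishing_order (F l) p = \<infinity>" if "l \<in> L" "p \<in> D" for l p
        unfolding vanishing_order_eq_infinity_iff
        using inD[OF that(2)] by eventually_elim (use True that in blast)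
      hence "mm p = \<infinity>" if "p \<in> D" for p
        using that L by (simp add: mm_def image_constant_conv cong: image_cong)
      moreover have "vanishing_order (\<lambda>z. 0) p = \<infinity>" "cnj_reflect (\<lambda>z. 0) = (\<lambda>z. 0)" for p
        by (simp_all add: vanishing_order_def cnj_reflect_def fun_eq_iff)
      ultimately show ?thesis by (intro h_goal[of "\<lambda>z. 0"]) (auto simp: N0)
    next
      case False
      then obtain l0 where l0: "l0 \<in> L" "\<not> (\<forall>z\<in>D. F l0 z = 0)" by blast
      have mm_fin: "mm p \<noteq> \<infinity>" if "p \<in> D" for p by (rule F_nonzero_order[OF that l0])
      \<comment> \<open>At a real point \<open>N\<close> would have the finite order 2m.\<close>
      have nonreal: "Im p \<noteq> 0" if p: "p \<in> D" for p
      proof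
        assume "Im p = 0"
        then obtain m where "mm p = enat m" "p \<in> \<real>" using mm_fin[OF p] by (auto simp: complex_is_Real_iff)
        hence "vanishing_order N p \<noteq> \<infinity>" using N_real[OF p] by simp
        moreover have "\<forall>\<^sub>F w in nhds p. N w = 0" using inD[OF p] by eventually_elim (rule N0)
        ultimately show False by (simp add: vanishing_order_eq_infinity_iff)
      qed
      define d where "d = (\<lambda>p. the_enat (mm p))"
      have d: "mm p = enat (d p)" if "p \<in> D" for p using mm_fin[OF that] by (auto simp: d_def)
      have "\<not> x islimpt {p\<in>D. d p \<noteq> 0}" if "x \<in> D" for x
      proof (rule limpt[OF that F(1)[OF l0(1)]])
        show "vanishing_order (F l0) x \<noteq> \<infinity>"
          using real_holomorphic_zero_propagates[OF D(1,2) conn F[OF l0(1)] that] l0(2)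
          by (auto simp: vanishing_order_eq_infinity_iff)
        fix p assume p: "p \<in> D" "d p \<noteq> 0"
        have "mm p \<le> vanishing_order (F l0) p" using L l0(1) by (simp add: mm_def)
        hence "vanishing_order (F l0) p \<noteq> 0"
          using p d[OF p(1)] by (auto simp: zero_enat_def)
        thus "F l0 p = 0" using vanishing_order_eq_0_iff[OF ana[OF F(1)[OF l0(1)] p(1)]] by blast
      qed
      then obtain a where a: "a holomorphic_on D" "\<And>p. p \<in> D \<Longrightarrow> vanishing_order a p = enat (d p)"
        using weierstrass_prescribed_zeros[OF D(1)] by metis
      \<comment> \<open>\<open>D\<close> is the disjoint union of two open halves, so the jump is
        harmless. Above the axis the reflection of \<open>h\<close> vanishes and has infinite order,
        which leaves the order of \<open>a\<close> as the minimum.\<close>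
      define h where "h = (\<lambda>z. if Im z > 0 then a z else 0)"
      have up: "open (D \<inter> {z. 0 < Im z})" "open (D \<inter> {z. Im z < 0})"
        using D(1) by (auto intro!: open_Int open_halfspace_Im_gt open_halfspace_Im_lt)
      have Dsplit: "D = (D \<inter> {z. 0 < Im z}) \<union> (D \<inter> {z. Im z < 0})"
        using nonreal by (auto simp: neq_iff)
      have "h holomorphic_on ((D \<inter> {z. 0 < Im z}) \<union> (D \<inter> {z. Im z < 0}))"
      proof (rule holomorphic_on_Un[OF _ _ up])
        show "h holomorphic_on (D \<inter> {z. 0 < Im z})"
          by (rule holomorphic_transform[of a]) (use a(1) holomorphic_on_subset in \<open>auto simp: h_def\<close>)
        show "h holomorphic_on (D \<inter> {z. Im z < 0})"
          by (rule holomorphic_transform[of "\<lambda>z. 0"]) (auto simp: h_def)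
      qed
      hence h_hol: "h holomorphic_on D" using Dsplit by simp
      show ?thesis
      proof (rule h_goal[OF h_hol])
        show "h z * cnj_reflect h z = N z" if "z \<in> D" for z
          using N0[OF that] by (simp add: h_def cnj_reflect_def)
        fix p assume p: "p \<in> D" "0 \<le> Im p"
        hence pos: "Im p > 0" using nonreal[OF p(1)] by simp
        have "\<forall>\<^sub>F w in nhds p. 0 < Im w"
          using eventually_nhds_in_open[OF open_halfspace_Im_gt, of p 0] pos by simp
        hence "\<forall>\<^sub>F w in nhds p. h w = a w" "\<forall>\<^sub>F w in nhds p. cnj_reflect h w = 0"
          by (eventually_elim, simp add: h_def cnj_reflect_def)+
        hence "vanishing_order h p = vanishing_order a p" "vanishing_order (cnj_reflect h) p = \<infinity>"
          by (auto simp: vanishing_order_eq_infinity_iff intro: vanishing_order_cong)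
        thus "min (vanishing_order h p) (vanishing_order (cnj_reflect h) p) = mm p"
          using a(2)[OF p(1)] d[OF p(1)] by simp
      qed
    qed
  next
    case False
    define M where "M = (\<lambda>p. the_enat (vanishing_order N p))"
    have M: "vanishing_order N p = enat (M p)" if "p \<in> D" for p
      using False that by (auto simp: M_def)
    have mm_fin: "mm p \<noteq> \<infinity>" if p: "p \<in> D" for p
    proof
      assume "mm p = \<infinity>"
      hence "vanishing_order (F l) p = \<infinity>" if "l \<in> L" for l
        using L that by (simp add: mm_def) (metis (no_types, lifting) Min_le enat_ord_simps(5) finite_imageI image_eqI)
      hence "\<forall>\<^sub>F w in nhds p. \<forall>l\<in>L. F l w = 0"
        using L(1) by (simp add: eventually_ball_finite vanishing_order_eq_infinity_iff)
      hence "\<forall>\<^sub>F w in nhds p. N w = 0" by eventually_elim (simp add: N_def)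
      thus False using M[OF p] by (metis enat.distinct(1) vanishing_order_eq_infinity_iff)
    qed
    define m where "m = (\<lambda>p. the_enat (mm p))"
    have m: "mm p = enat (m p)" if "p \<in> D" for p using mm_fin[OF that] by (auto simp: m_def)
    have M_cnj: "M (cnj p) = M p" and m_cnj: "m (cnj p) = m p" if "p \<in> D" for p
      using vanishing_order_cnj[OF D(1,2) N_hol N_cnj that] mm_cnj[OF that] by (simp_all add: M_def m_def)
    have mM: "2 * m p \<le> M p" if "p \<in> D" for p
      using N_ge[OF that m[OF that]] M[OF that] by simp
    have mM_real: "2 * m p = M p" if "p \<in> D" "Im p = 0" for p
      using N_real[OF that(1) m[OF that(1)]] M[OF that(1)] that(2) by (simp add: complex_is_Real_iff)
    \<comment> \<open>At conjugate points the two values add up to M, as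
      \<open>a * cnj_reflect a\<close> requires, and their minimum is m because 2m \<le> M. On the
      real axis, M = 2m makes the same hold with both points equal.\<close>
    define d where "d = (\<lambda>p. if Im p \<ge> 0 then m p else M p - m p)"
    have "\<not> x islimpt {p\<in>D. d p \<noteq> 0}" if "x \<in> D" for x
    proof (rule limpt[OF that N_hol])
      show "vanishing_order N x \<noteq> \<infinity>" using M[OF that] by simp
      fix p assume p: "p \<in> D" "d p \<noteq> 0"
      hence "M p \<noteq> 0" using mM[OF p(1)] by (auto simp: d_def split: if_splits)
      hence "vanishing_order N p \<noteq> 0" using M[OF p(1)] by (simp add: zero_enat_def)
      thus "N p = 0" using vanishing_order_eq_0_iff[OF ana[OF N_hol p(1)]] by blast
    qed
    then obtain a where a: "a holomorphic_on D" "\<And>p. p \<in> D \<Longrightarrow> vanishing_order a p = enat (d p)"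
      using weierstrass_prescribed_zeros[OF D(1)] by metis
    have a'_hol: "cnj_reflect a holomorphic_on D" by (rule holomorphic_on_cnj_reflect[OF a(1) D(1,2)])
    have a': "vanishing_order (cnj_reflect a) p = enat (d (cnj p))" if "p \<in> D" for p
      using vanishing_order_cnj_reflect[of a p] ana[OF a(1) cnjD[OF that]] a(2)[OF cnjD[OF that]] by simp
    define b where "b = (\<lambda>z. a z * cnj_reflect a z)"
    have b_hol: "b holomorphic_on D" unfolding b_def by (intro holomorphic_intros a a'_hol)
    have b_ord: "vanishing_order b p = enat (M p)" if "p \<in> D" for p
    proof -
      have "d p + d (cnj p) = M p"
        using mM[OF that] mM_real[OF that] M_cnj[OF that] m_cnj[OF that] by (auto simp: d_def)
      thus ?thesis unfolding b_def
        using vanishing_order_mult[OF ana[OF a(1) that] ana[OF a'_hol that]] a(2)[OF that] a'[OF that]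
        by simp
    qed
    obtain v where v: "v holomorphic_on D" "\<And>z. z \<in> D \<Longrightarrow> v z \<noteq> 0" "\<And>z. z \<in> D \<Longrightarrow> N z = b z * v z"
        "\<And>z. z \<in> D \<Longrightarrow> (\<lambda>w. N w / b w) \<midarrow>z\<rightarrow> v z"
      by (rule holomorphic_quotient_same_orders[OF D(1) N_hol b_hol]) (use M b_ord in simp_all)
    \<comment> \<open>Along the real axis \<open>N / b\<close> is a sum of real squares over |a|^2,
      hence nonnegative, also where division by 0 yields 0. The limit is nonnegative, and
      \<open>v\<close> has no zeros.\<close>
    have v_real: "v z \<in> \<real> \<and> Re (v z) > 0" if z: "z \<in> D" "z \<in> \<real>" for z
    proof -
      have "at z within \<real> \<noteq> bot" by (rule at_within_Reals_neq_bot) fact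
      moreover have "((\<lambda>w. N w / b w) \<longlongrightarrow> v z) (at z within \<real>)"
        using v(4)[OF z(1)] by (rule tendsto_within_subset) simp
      moreover have "\<forall>\<^sub>F w in at z within \<real>. N w / b w \<in> \<real>\<^sub>\<ge>\<^sub>0"
        unfolding eventually_at_filter using inD[OF z(1)]
      proof eventually_elim
        case (elim w)
        show ?case
        proof (intro impI)
          assume w: "w \<in> \<real>"
          have "b w = of_real (norm (a w) ^ 2)"
            using w complex_norm_square[of "a w"] by (simp add: b_def cnj_reflect_def Reals_cnj_iff)
          moreover have "N w = of_real (\<Sum>l\<in>L. (Re (F l w))\<^sup>2)"
          proof -
            have "F l w = of_real (Re (F l w))" if "l \<in> L" for l
            proof -
              have "cnj w = w" using w by (simp add: Reals_cnj_iff)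
              with F(2)[OF that elim] have "F l w \<in> \<real>" by (simp add: Reals_cnj_iff)
              thus ?thesis by (simp add: complex_is_Real_iff complex_eq_iff)
            qed
            hence "N w = (\<Sum>l\<in>L. of_real (Re (F l w)) ^ 2)" unfolding N_def by (metis (no_types, lifting) sum.cong)
            thus ?thesis by simp
          qed
          ultimately have "N w / b w = of_real ((\<Sum>l\<in>L. (Re (F l w))\<^sup>2) / norm (a w) ^ 2)"
            by simp
          moreover have "(\<Sum>l\<in>L. (Re (F l w))\<^sup>2) / norm (a w) ^ 2 \<ge> 0"
            by (intro divide_nonneg_nonneg sum_nonneg) auto
          ultimately show "N w / b w \<in> \<real>\<^sub>\<ge>\<^sub>0"
            by (metis nonneg_Reals_of_real_iff)
        qed
      qed
      ultimately have "v z \<in> \<real>\<^sub>\<ge>\<^sub>0"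
        by - (rule Lim_in_closed_set[OF closed_nonneg_Reals_complex], assumption+)
      with v(2)[OF z(1)] show ?thesis
        by (auto simp: complex_nonneg_Reals_iff complex_is_Real_iff complex_eq_iff less_le)
    qed
    obtain w where w: "w holomorphic_on D" "\<And>z. w (cnj z) = cnj (w z)"
        "\<And>z. z \<in> D \<Longrightarrow> Im z \<ge> 0 \<Longrightarrow> w z ^ 2 = v z"
      using real_holomorphic_sqrt[OF D v(1,2) v_real] by blast
    have w_nz: "w z \<noteq> 0" if "z \<in> D" for z
    proof (cases "Im z \<ge> 0")
      case True
      thus ?thesis using w(3)[OF that] v(2)[OF that] by auto
    next
      case False
      hence "w (cnj z) ^ 2 = v (cnj z)" using w(3)[OF cnjD[OF that]] by simp
      thus ?thesis using w(2)[of z] v(2)[OF cnjD[OF that]] by auto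
    qed
    define h where "h = (\<lambda>z. a z * w z)"
    have h_hol: "h holomorphic_on D" unfolding h_def by (intro holomorphic_intros a w)
    \<comment> \<open>The root \<open>w\<close> is fixed by the reflection, so it enters h and h*
      alike: their product acquires w^2, and their orders stay those of \<open>a\<close> and its
      reflection.\<close>
    have h': "cnj_reflect h = (\<lambda>z. cnj_reflect a z * w z)"
      by (simp add: h_def cnj_reflect_def fun_eq_iff w(2))
    have w0: "vanishing_order w p = 0" if "p \<in> D" for p
      using vanishing_order_eq_0_iff[OF ana[OF w(1) that]] w_nz[OF that] by simp
    show ?thesis
    proof (rule h_goal[OF h_hol])
      have upper: "h z * cnj_reflect h z = N z" if "z \<in> D" "Im z \<ge> 0" for z
        using v(3)[OF that(1)] unfolding w(3)[OF that, symmetric] h'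
        by (simp add: h_def b_def power2_eq_square mult_ac)
      show "h z * cnj_reflect h z = N z" if z: "z \<in> D" for z
      proof (cases "Im z \<ge> 0")
        case False
        hence "h (cnj z) * cnj_reflect h (cnj z) = cnj (N z)"
          using upper[OF cnjD[OF z]] N_cnj[OF z] by simp
        hence "cnj (h (cnj z) * cnj_reflect h (cnj z)) = N z" by simp
        thus ?thesis by (simp add: cnj_reflect_def mult.commute)
      qed (use upper z in blast)
      fix p assume p: "p \<in> D" "0 \<le> Im p"
      have "vanishing_order h p = enat (d p)"
        unfolding h_def using vanishing_order_mult[OF ana[OF a(1) p(1)] ana[OF w(1) p(1)]] a(2)[OF p(1)] w0[OF p(1)]
        by simp
      moreover have "vanishing_order (cnj_reflect h) p = enat (d (cnj p))"
        unfolding h' using vanishing_order_mult[OF ana[OF a'_hol p(1)] ana[OF w(1) p(1)]] a'[OF p(1)] w0[OF p(1)]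
        by simp
      moreover have "min (d p) (d (cnj p)) = m p"
        using mM[OF p(1)] M_cnj[OF p(1)] m_cnj[OF p(1)] p(2) by (auto simp: d_def)
      ultimately show "min (vanishing_order h p) (vanishing_order (cnj_reflect h) p) = mm p"
        using m[OF p(1)] by (simp add: min_def split: if_splits)
    qed
  qed
qed

text \<open>\<open>g1\<close> and \<open>g2\<close> are the real and imaginary parts of
  \<open>h\<close> with respect to the reflection instead of pointwise conjugation, which keeps them
  holomorphic. The change of variables is linear and invertible, so the minimum of the orders is
  preserved.\<close>

corollary real_sum_of_two_squares:
  fixes F :: "'i \<Rightarrow> complex \<Rightarrow> complex"
  assumes L: "finite L" "L \<noteq> {}"
    and D: "open D" "cnj ` D = D" "simply_connected (D \<inter> {z. 0 < Im z})"
    and F: "\<And>l. l \<in> L \<Longrightarrow> F l holomorphic_on D"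
      "\<And>l z. l \<in> L \<Longrightarrow> z \<in> D \<Longrightarrow> F l (cnj z) = cnj (F l z)"
  obtains g1 g2 where "g1 holomorphic_on D" "g2 holomorphic_on D"
    "\<And>z. g1 (cnj z) = cnj (g1 z)" "\<And>z. g2 (cnj z) = cnj (g2 z)"
    "\<And>z. z \<in> D \<Longrightarrow> g1 z ^ 2 + g2 z ^ 2 = (\<Sum>l\<in>L. F l z ^ 2)"
    "\<And>p. p \<in> D \<Longrightarrow> min (vanishing_order g1 p) (vanishing_order g2 p)
        = Min ((\<lambda>l. vanishing_order (F l) p) ` L)"
proof -
  obtain h where h: "h holomorphic_on D"
    "\<And>z. z \<in> D \<Longrightarrow> h z * cnj_reflect h z = (\<Sum>l\<in>L. F l z ^ 2)"
    "\<And>p. p \<in> D \<Longrightarrow> min (vanishing_order h p) (vanishing_order (cnj_reflect h) p)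
        = Min ((\<lambda>l. vanishing_order (F l) p) ` L)"
    using real_factorization_of_sum_of_squares[where F = F, OF L D F] by blast
  define k where "k = cnj_reflect h"
  define g1 where "g1 = (\<lambda>z. 1 / 2 * h z + 1 / 2 * k z)"
  define g2 where "g2 = (\<lambda>z. - \<i> / 2 * h z + \<i> / 2 * k z)"
  have k: "k holomorphic_on D" unfolding k_def by (rule holomorphic_on_cnj_reflect[OF h(1) D(1,2)])
  show ?thesis
  proof (rule that)
    show g: "g1 holomorphic_on D" "g2 holomorphic_on D"
      unfolding g1_def g2_def by (intro holomorphic_intros h k)+
    show "g1 (cnj z) = cnj (g1 z)" "g2 (cnj z) = cnj (g2 z)" for z
      by (simp_all add: g1_def g2_def k_def cnj_reflect_def)
    have "g1 z ^ 2 + g2 z ^ 2 = h z * k z" for z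
      by (simp add: g1_def g2_def power2_eq_square field_simps)
    thus "g1 z ^ 2 + g2 z ^ 2 = (\<Sum>l\<in>L. F l z ^ 2)" if "z \<in> D" for z
      using h(2)[OF that] by (simp add: k_def)
    fix p assume p: "p \<in> D"
    note ana = analytic_at_holomorphic_on[OF _ D(1) p]
    \<comment> \<open>The coefficient 1 is written out to match the linear combinations in
      \<open>vanishing_order_linear_ge\<close>.\<close>
    have hk: "h = (\<lambda>z. 1 * g1 z + \<i> * g2 z)" "k = (\<lambda>z. 1 * g1 z + (- \<i>) * g2 z)"
      by (simp_all add: g1_def g2_def fun_eq_iff field_simps)
    have "min (vanishing_order h p) (vanishing_order k p) \<le> min (vanishing_order g1 p) (vanishing_order g2 p)"
      unfolding g1_def g2_def by (intro min.boundedI vanishing_order_linear_ge ana h k)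
    moreover have "min (vanishing_order g1 p) (vanishing_order g2 p) \<le> vanishing_order h p"
      by (subst hk(1)) (intro vanishing_order_linear_ge ana g)
    moreover have "min (vanishing_order g1 p) (vanishing_order g2 p) \<le> vanishing_order k p"
      by (subst hk(2)) (intro vanishing_order_linear_ge ana g)
    ultimately have "min (vanishing_order g1 p) (vanishing_order g2 p)
        = min (vanishing_order h p) (vanishing_order k p)"
      by (metis antisym min.boundedI)
    thus "min (vanishing_order g1 p) (vanishing_order g2 p)
        = Min ((\<lambda>l. vanishing_order (F l) p) ` L)"
      using h(3)[OF p] by (simp add: k_def)
  qed
qed

section \<open>Slice functions over alternative quadratic algebras\<close>

text \<open>These laws are shared by quaternions and octonions. Alternativity stands in for
  associativity: the left law gives I(Ix) = -x, the right law (Jy)y = J(yy).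
  \<open>square_eq\<close> is the quadratic equation of x with trace and norm as coefficients.
  Distinct imaginary basis vectors anticommute by polarization, so of \<open>e1\<close> and
  \<open>e2\<close> only their product needs a condition.\<close>

locale slice_quadratic_algebra = slice_algebra mult conj one
  for mult :: "'a::euclidean_space \<Rightarrow> 'a \<Rightarrow> 'a" (infixl "\<odot>" 70) and conj and one +
  assumes bilinear_mult: "bilinear mult"
    and one_left: "one \<odot> x = x" and one_right: "x \<odot> one = x"
    and one_Basis: "one \<in> Basis"
    and conj_eq: "conj x = (2 * (x \<bullet> one)) *\<^sub>R one - x"
    and square_eq: "x \<odot> x = (2 * (x \<bullet> one)) *\<^sub>R x - (x \<bullet> x) *\<^sub>R one"
    and left_alternative: "x \<odot> (x \<odot> y) = (x \<odot> x) \<odot> y"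
    and right_alternative: "(y \<odot> x) \<odot> x = y \<odot> (x \<odot> x)"
    and ex_anticommuting_units:
      "\<exists>e1\<in>Basis - {one}. \<exists>e2\<in>Basis - {one}. e1 \<noteq> e2 \<and> e1 \<odot> e2 \<in> slice_algebra.imag_units mult one"
begin

lemmas mult_simps =
  bilinear_ladd[OF bilinear_mult] bilinear_radd[OF bilinear_mult]
  bilinear_lmul[OF bilinear_mult] bilinear_rmul[OF bilinear_mult]
  bilinear_lneg[OF bilinear_mult] bilinear_rneg[OF bilinear_mult]
  bilinear_lsub[OF bilinear_mult] bilinear_rsub[OF bilinear_mult]
  bilinear_lzero[OF bilinear_mult] bilinear_rzero[OF bilinear_mult]
  one_left one_right

lemma inner_one_one [simp]: "one \<bullet> one = 1"
  using one_Basis by simp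

text \<open>Pairing the quadratic equation with \<open>I\<close> gives (I \<bullet> one)(I \<bullet>
  I + 1) = 0, whose second factor is positive; pairing with \<open>one\<close> then fixes the
  norm.\<close>

lemma imag_units_iff: "I \<in> imag_units \<longleftrightarrow> I \<bullet> one = 0 \<and> I \<bullet> I = 1"
proof
  assume "I \<in> imag_units"
  hence eq: "(2 * (I \<bullet> one)) *\<^sub>R I - (I \<bullet> I) *\<^sub>R one = - one"
    using square_eq[of I] by (simp add: imag_units_def)
  have "(I \<bullet> one) * (I \<bullet> I + 1) = 0"
    using arg_cong[OF eq, of "\<lambda>x. x \<bullet> I"] by (simp add: inner_diff_left inner_commute[of one] algebra_simps)
  moreover have "I \<bullet> I + 1 \<noteq> 0" using inner_ge_zero[of I] by linarith
  ultimately have "I \<bullet> one = 0" by simp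
  moreover from this have "I \<bullet> I = 1"
    using arg_cong[OF eq, of "\<lambda>x. x \<bullet> one"] by simp
  ultimately show "I \<bullet> one = 0 \<and> I \<bullet> I = 1" by simp
next
  assume "I \<bullet> one = 0 \<and> I \<bullet> I = 1"
  thus "I \<in> imag_units" using square_eq[of I] by (simp add: imag_units_def)
qed

lemma imag_units_uminus: "I \<in> imag_units \<Longrightarrow> - I \<in> imag_units"
  by (simp add: imag_units_iff)

lemma mult_imag_unit_twice: "I \<in> imag_units \<Longrightarrow> I \<odot> (I \<odot> x) = - x"
  by (simp add: left_alternative imag_units_def mult_simps)

text \<open>The component along \<open>one\<close> determines \<alpha>, and the norm of the rest
  determines \<beta> up to sign. At a real point the two units are unrelated, hence the first
  alternative.\<close>

lemma slice_representation_unique: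
  assumes I: "I \<in> imag_units" "J \<in> imag_units"
    and eq: "\<alpha> *\<^sub>R one + \<beta> *\<^sub>R I = \<alpha>' *\<^sub>R one + \<beta>' *\<^sub>R J"
  shows "\<alpha> = \<alpha>'" "\<beta> = 0 \<and> \<beta>' = 0 \<or> \<beta> = \<beta>' \<and> I = J \<or> \<beta> = - \<beta>' \<and> I = - J"
proof -
  note I' = I[unfolded imag_units_iff]
  show "\<alpha> = \<alpha>'"
    using arg_cong[OF eq, of "\<lambda>x. x \<bullet> one"] I' by (simp add: inner_add_left)
  with eq have eq': "\<beta> *\<^sub>R I = \<beta>' *\<^sub>R J" by simp
  have "\<beta> * \<beta> = \<beta>' * \<beta>'"
    using arg_cong[OF eq', of "\<lambda>x. x \<bullet> x"] I' by simp
  hence "\<beta> = \<beta>' \<or> \<beta> = - \<beta>'" by (simp add: square_eq_iff)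
  thus "\<beta> = 0 \<and> \<beta>' = 0 \<or> \<beta> = \<beta>' \<and> I = J \<or> \<beta> = - \<beta>' \<and> I = - J"
  proof
    assume b: "\<beta> = \<beta>'"
    with eq' show ?thesis by (cases "\<beta> = 0") auto
  next
    assume b: "\<beta> = - \<beta>'"
    with eq' have "\<beta>' *\<^sub>R (- I) = \<beta>' *\<^sub>R J" by simp
    hence "\<beta>' = 0 \<or> - I = J" by (simp only: scaleR_cancel_left disj_commute)
    with b show ?thesis by auto
  qed
qed

lemma stem_function_real_point:
  assumes "stem_function D F" "Complex \<alpha> 0 \<in> D"
  shows "snd (F (Complex \<alpha> 0)) = 0"
proof -
  have "cnj (Complex \<alpha> 0) = Complex \<alpha> 0" by (simp add: complex_eq_iff)
  with assms have "F (Complex \<alpha> 0) = complex_bar (F (Complex \<alpha> 0))"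
    unfolding stem_function_def by metis
  hence "snd (F (Complex \<alpha> 0)) = - snd (F (Complex \<alpha> 0))"
    by (metis complex_bar_def snd_conv)
  thus ?thesis by (simp add: eq_neg_iff_add_eq_0 flip: scaleR_2)
qed

text \<open>This discharges the \<open>THE\<close>. Under (\<beta>, I) \<mapsto> (-\<beta>, -I) the
  second stem component and the unit both change sign; at a real point that component is 0.\<close>

lemma induced_eq:
  assumes F: "stem_function D F" and z: "Complex \<alpha> \<beta> \<in> D" and I: "I \<in> imag_units"
  shows "induced D F (\<alpha> *\<^sub>R one + \<beta> *\<^sub>R I) = fst (F (Complex \<alpha> \<beta>)) + I \<odot> snd (F (Complex \<alpha> \<beta>))"
  unfolding induced_def
proof (rule the_equality)
  show "\<exists>\<alpha>' \<beta>' I'. Complex \<alpha>' \<beta>' \<in> D \<and> I' \<in> imag_units \<and>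
      \<alpha> *\<^sub>R one + \<beta> *\<^sub>R I = \<alpha>' *\<^sub>R one + \<beta>' *\<^sub>R I' \<and>
      fst (F (Complex \<alpha> \<beta>)) + I \<odot> snd (F (Complex \<alpha> \<beta>)) =
      fst (F (Complex \<alpha>' \<beta>')) + I' \<odot> snd (F (Complex \<alpha>' \<beta>'))"
    using z I by blast
next
  fix y assume "\<exists>\<alpha>' \<beta>' I'. Complex \<alpha>' \<beta>' \<in> D \<and> I' \<in> imag_units \<and>
      \<alpha> *\<^sub>R one + \<beta> *\<^sub>R I = \<alpha>' *\<^sub>R one + \<beta>' *\<^sub>R I' \<and>
      y = fst (F (Complex \<alpha>' \<beta>')) + I' \<odot> snd (F (Complex \<alpha>' \<beta>'))"
  then obtain \<alpha>' \<beta>' I' where z': "Complex \<alpha>' \<beta>' \<in> D" "I' \<in> imag_units"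
      "\<alpha> *\<^sub>R one + \<beta> *\<^sub>R I = \<alpha>' *\<^sub>R one + \<beta>' *\<^sub>R I'"
    and y: "y = fst (F (Complex \<alpha>' \<beta>')) + I' \<odot> snd (F (Complex \<alpha>' \<beta>'))" by blast
  note u = slice_representation_unique[OF I z'(2,3)]
  from u(2) show "y = fst (F (Complex \<alpha> \<beta>)) + I \<odot> snd (F (Complex \<alpha> \<beta>))"
  proof (elim disjE conjE)
    assume "\<beta> = 0" "\<beta>' = 0"
    thus ?thesis using y u(1) stem_function_real_point[OF F] z by (simp add: mult_simps)
  next
    assume "\<beta> = \<beta>'" "I = I'"
    thus ?thesis using y u(1) by simp
  next
    assume b: "\<beta> = - \<beta>'" "I = - I'"
    have "F (cnj (Complex \<alpha> \<beta>)) = complex_bar (F (Complex \<alpha> \<beta>))"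
      using F z by (simp add: stem_function_def)
    moreover have "cnj (Complex \<alpha> \<beta>) = Complex \<alpha>' \<beta>'"
      using b(1) u(1) by (simp add: complex_eq_iff)
    ultimately show ?thesis using y b(2) by (simp add: complex_bar_def mult_simps)
  qed
qed

lemma circular_setE:
  assumes "x \<in> circular_set D"
  obtains \<alpha> \<beta> I where "Complex \<alpha> \<beta> \<in> D" "I \<in> imag_units" "x = \<alpha> *\<^sub>R one + \<beta> *\<^sub>R I"
  using assms unfolding circular_set_def by blast

lemma induced_cong:
  assumes "\<And>z. z \<in> D \<Longrightarrow> F z = G z"
  shows "induced D F = induced D G"
proof
  fix x
  have "(\<exists>\<alpha> \<beta> I. Complex \<alpha> \<beta> \<in> D \<and> I \<in> imag_units \<and> x = \<alpha> *\<^sub>R one + \<beta> *\<^sub>R I \<and>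
          y = fst (F (Complex \<alpha> \<beta>)) + I \<odot> snd (F (Complex \<alpha> \<beta>))) \<longleftrightarrow>
        (\<exists>\<alpha> \<beta> I. Complex \<alpha> \<beta> \<in> D \<and> I \<in> imag_units \<and> x = \<alpha> *\<^sub>R one + \<beta> *\<^sub>R I \<and>
          y = fst (G (Complex \<alpha> \<beta>)) + I \<odot> snd (G (Complex \<alpha> \<beta>)))" for y
    using assms by metis
  thus "induced D F x = induced D G x" by (simp add: induced_def)
qed

lemma ex_imag_unit: "\<exists>I. I \<in> imag_units"
  using ex_anticommuting_units by blast

text \<open>The values at the units I and -I determine both components: their sum gives the first,
  and multiplying by I once more recovers the second.\<close>

lemma stem_function_unique:
  assumes F: "stem_function D F" and G: "stem_function D G"
    and eq: "\<And>x. x \<in> circular_set D \<Longrightarrow> induced D F x = induced D G x" and z: "z \<in> D"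
  shows "F z = G z"
proof -
  obtain I where I: "I \<in> imag_units" using ex_imag_unit by blast
  obtain \<alpha> \<beta> where ab: "z = Complex \<alpha> \<beta>" by (cases z)
  have *: "fst (F z) + J \<odot> snd (F z) = fst (G z) + J \<odot> snd (G z)" if J: "J \<in> imag_units" for J
  proof -
    have "\<alpha> *\<^sub>R one + \<beta> *\<^sub>R J \<in> circular_set D"
      using z ab J unfolding circular_set_def by blast
    thus ?thesis using eq induced_eq[OF F _ J] induced_eq[OF G _ J] z ab by metis
  qed
  have p: "fst (F z) + I \<odot> snd (F z) = fst (G z) + I \<odot> snd (G z)"
    and m: "fst (F z) - I \<odot> snd (F z) = fst (G z) - I \<odot> snd (G z)"
    using *[OF I] *[OF imag_units_uminus[OF I]] by (simp_all add: mult_simps)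
  have "2 *\<^sub>R fst (F z) = 2 *\<^sub>R fst (G z)"
    using arg_cong2[OF p m, of "(+)"] by (simp add: scaleR_2)
  hence 1: "fst (F z) = fst (G z)" by simp
  with p have "I \<odot> snd (F z) = I \<odot> snd (G z)" by simp
  hence "I \<odot> (I \<odot> snd (F z)) = I \<odot> (I \<odot> snd (G z))" by simp
  hence "snd (F z) = snd (G z)" by (simp add: mult_imag_unit_twice[OF I])
  with 1 show ?thesis by (simp add: prod_eq_iff)
qed

text \<open>The choice in \<open>stem_of\<close> may thus be replaced on \<open>D\<close> by any
  stem function at hand, in particular by a holomorphic one.\<close>

lemma stem_of_eq:
  assumes F: "stem_function D F" "\<And>x. x \<in> circular_set D \<Longrightarrow> f x = induced D F x" and z: "z \<in> D"
  shows "stem_of D f z = F z"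
proof -
  have "stem_function D (stem_of D f) \<and> (\<forall>x\<in>circular_set D. f x = induced D (stem_of D f) x)"
    unfolding stem_of_def by (rule someI[of _ F]) (use F in blast)
  thus ?thesis using stem_function_unique[OF _ F(1) _ z] F(2) by metis
qed

lemma coord_complex_bar: "coord e (complex_bar w) = cnj (coord e w)"
  by (simp add: coord_def complex_bar_def complex_eq_iff)

section \<open>Trace, norm and central divisor in coordinates\<close>

lemma imaginary_square:
  assumes "v \<bullet> one = 0"
  shows "v \<odot> v = - (v \<bullet> v) *\<^sub>R one"
  using assms square_eq[of v] by simp

lemma imaginary_anticommutator:
  assumes "v \<bullet> one = 0" "w \<bullet> one = 0"
  shows "v \<odot> w + w \<odot> v = - (2 * (v \<bullet> w)) *\<^sub>R one"
proof -
  have "(v + w) \<odot> (v + w) = - ((v + w) \<bullet> (v + w)) *\<^sub>R one"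
    by (rule imaginary_square) (simp add: inner_add_left assms)
  hence "v \<odot> w + w \<odot> v + (2 * (v \<bullet> w)) *\<^sub>R one = 0"
    by (simp add: mult_simps imaginary_square assms inner_add_left inner_add_right
        inner_commute[of w v] algebra_simps)
  thus ?thesis by (simp add: eq_neg_iff_add_eq_0)
qed

lemma inner_imaginary:
  assumes "v \<bullet> one = 0"
  shows "v \<bullet> w = (\<Sum>e\<in>Basis - {one}. (v \<bullet> e) * (w \<bullet> e))"
proof -
  have "v \<bullet> w = (v \<bullet> one) * (w \<bullet> one) + (\<Sum>e\<in>Basis - {one}. (v \<bullet> e) * (w \<bullet> e))"
    unfolding euclidean_inner[of v w] by (rule sum.remove) (auto simp: one_Basis)
  with assms show ?thesis by simp
qed

text \<open>For imaginary a, b the conjugate of the pair is its negative, so the product has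
  components b^2 - a^2 and -(ab + ba). Both are real multiples of \<open>one\<close>, by the square
  law and its polarization.\<close>

lemma complexified_norm_imaginary:
  assumes "coord one w = 0"
  shows "complexified_mult w (complexified_conj w) =
    complex_embed (\<Sum>e\<in>Basis - {one}. coord e w ^ 2)"
proof -
  obtain a b where w: "w = (a, b)" by (cases w)
  have ab: "a \<bullet> one = 0" "b \<bullet> one = 0" using assms by (auto simp: w coord_def complex_eq_iff)
  have "(\<Sum>e\<in>Basis - {one}. coord e w ^ 2) = Complex (a \<bullet> a - b \<bullet> b) (2 * (a \<bullet> b))"
    unfolding inner_imaginary[OF ab(1), of a] inner_imaginary[OF ab(2), of b] inner_imaginary[OF ab(1), of b]
    by (simp add: complex_eq_iff w coord_def power2_eq_square sum_subtractf sum_distrib_left mult_ac)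
  moreover have "complexified_mult w (complexified_conj w) = (b \<odot> b - a \<odot> a, - (a \<odot> b + b \<odot> a))"
    by (simp add: complexified_mult_def complexified_conj_def w conj_eq ab mult_simps)
  ultimately show ?thesis
    by (simp add: complex_embed_def imaginary_square ab imaginary_anticommutator algebra_simps)
qed

lemma stem_function_complexified_conj:
  "stem_function D F \<Longrightarrow> stem_function D (\<lambda>z. complexified_conj (F z))"
  by (simp add: stem_function_def complexified_conj_def complex_bar_def conj_eq)

lemma
  assumes F: "stem_function D F" "\<And>x. x \<in> circular_set D \<Longrightarrow> f x = induced D F x"
    and im: "\<And>z. z \<in> D \<Longrightarrow> coord one (F z) = 0"
  shows slice_trace_imaginary: "x \<in> circular_set D \<Longrightarrow> slice_trace D f x = 0"
    and slice_norm_imaginary: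
      "slice_norm D f = induced D (\<lambda>z. complex_embed (\<Sum>e\<in>Basis - {one}. coord e (F z) ^ 2))"
proof -
  let ?C = "\<lambda>z. complexified_conj (F z)"
  have stem: "stem_of D f z = F z" if "z \<in> D" for z
    by (rule stem_of_eq[OF F that])
  have conj: "slice_conj D f = induced D ?C"
    unfolding slice_conj_def by (rule induced_cong) (simp add: stem)
  have C: "stem_function D ?C" by (rule stem_function_complexified_conj[OF F(1)])
  show "slice_trace D f x = 0" if x: "x \<in> circular_set D"
  proof -
    obtain \<alpha> \<beta> I where z: "Complex \<alpha> \<beta> \<in> D" and I: "I \<in> imag_units" and xeq: "x = \<alpha> *\<^sub>R one + \<beta> *\<^sub>R I"
      using circular_setE[OF x] .
    have "fst (F (Complex \<alpha> \<beta>)) \<bullet> one = 0" "snd (F (Complex \<alpha> \<beta>)) \<bullet> one = 0"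
      using im[OF z] by (auto simp: coord_def complex_eq_iff)
    thus ?thesis
      using F(2)[OF x] induced_eq[OF F(1) z I] induced_eq[OF C z I]
      by (simp add: slice_trace_def conj xeq complexified_conj_def conj_eq mult_simps)
  qed
  have "stem_of D (slice_conj D f) z = ?C z" if "z \<in> D" for z
    by (rule stem_of_eq[OF C _ that]) (simp add: conj)
  thus "slice_norm D f = induced D (\<lambda>z. complex_embed (\<Sum>e\<in>Basis - {one}. coord e (F z) ^ 2))"
    unfolding slice_norm_def slice_product_def
    by (intro induced_cong) (simp add: stem complexified_norm_imaginary im)
qed

text \<open>\<open>stem_of\<close> and \<open>F\<close> agree only on \<open>D\<close>, but
  \<open>D\<close> is open, so their germs at \<open>p\<close> and hence the orders
  coincide.\<close>

lemma central_divisor_eq: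
  assumes F: "stem_function D F" "\<And>x. x \<in> circular_set D \<Longrightarrow> f x = induced D F x"
    and D: "open D" "p \<in> D"
  shows "central_divisor D f p = Min ((\<lambda>e. vanishing_order (\<lambda>z. coord e (F z)) p) ` (Basis - {one}))"
proof -
  have "\<forall>\<^sub>F z in nhds p. z \<in> D" using D by (rule eventually_nhds_in_open)
  hence "\<forall>\<^sub>F z in nhds p. coord e (stem_of D f z) = coord e (F z)" for e
    by eventually_elim (simp add: stem_of_eq[OF F])
  hence "vanishing_order (\<lambda>z. coord e (stem_of D f z)) p = vanishing_order (\<lambda>z. coord e (F z)) p" for e
    by (rule vanishing_order_cong)
  thus ?thesis using D(2) by (simp add: central_divisor_def)
qed

text \<open>Vanishing of the component as a function on the circular set passes to the stem function
  by uniqueness, with the zero stem function as comparison.\<close>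

lemma purely_vectorial_coord:
  assumes F: "stem_function D F" "\<And>x. x \<in> circular_set D \<Longrightarrow> f x = induced D F x"
    and pv: "purely_vectorial D f" and z: "z \<in> D"
  shows "coord one (F z) = 0"
proof -
  let ?E = "\<lambda>z. complex_embed (coord one (F z))"
  have E: "stem_function D ?E"
    using F(1) by (simp add: stem_function_def coord_complex_bar) (simp add: complex_embed_def complex_bar_def)
  have Z: "stem_function D (\<lambda>z. (0, 0))" by (simp add: stem_function_def complex_bar_def)
  have "induced D ?E x = induced D (\<lambda>z. (0, 0)) x" if x: "x \<in> circular_set D" for x
  proof -
    have "induced D ?E x = slice_component D f one x"
      unfolding slice_component_def
      by (rule fun_cong[OF induced_cong]) (simp add: stem_of_eq[OF F])
    also have "\<dots> = 0" using pv x by (simp add: purely_vectorial_def)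
    finally have "induced D ?E x = 0" .
    moreover obtain \<alpha> \<beta> I where "Complex \<alpha> \<beta> \<in> D" "I \<in> imag_units" "x = \<alpha> *\<^sub>R one + \<beta> *\<^sub>R I"
      using circular_setE[OF x] .
    ultimately show ?thesis using induced_eq[OF Z] by (simp add: mult_simps)
  qed
  from stem_function_unique[OF E Z this z] show ?thesis
    using one_Basis nonzero_Basis by (auto simp: complex_embed_def complex_eq_iff)
qed

text \<open>The map x + iy \<mapsto> x + yJ is a homeomorphism onto the half slice, where simple
  connectedness is assumed.\<close>

lemma simply_connected_upper_half:
  assumes "basic_domain D"
  shows "simply_connected (D \<inter> {z. 0 < Im z})"
proof -
  obtain J where J: "J \<in> imag_units" using ex_imag_unit by blast
  note J' = J[unfolded imag_units_iff]
  let ?U = "D \<inter> {z. 0 < Im z}" and ?S = "circular_set D \<inter> half_slice J"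
  have cnjD: "cnj z \<in> D" if "z \<in> D" for z
    using assms that by (auto simp: basic_domain_def circular_domain_def)
  define h where "h = (\<lambda>z. Re z *\<^sub>R one + Im z *\<^sub>R J)"
  define k :: "'a \<Rightarrow> complex" where "k = (\<lambda>x. of_real (x \<bullet> one) + \<i> * of_real (x \<bullet> J))"
  have kh: "k (h z) = z" for z
    using J' by (simp add: h_def k_def inner_add_left inner_commute[of one J] complex_eq_iff)
  have hS: "h ` ?U = ?S"
  proof (intro equalityI subsetI)
    fix x assume "x \<in> h ` ?U"
    then obtain z where z: "z \<in> D" "0 < Im z" "x = h z" by auto
    have "x \<in> circular_set D"
      unfolding circular_set_def using z J
      by (intro CollectI exI[of _ "Re z"] exI[of _ "Im z"] exI[of _ J]) (simp add: h_def)
    moreover have "x \<in> half_slice J" unfolding half_slice_def using z by (auto simp: h_def)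
    ultimately show "x \<in> ?S" by blast
  next
    fix x assume x: "x \<in> ?S"
    obtain a b where ab: "x = a *\<^sub>R one + b *\<^sub>R J" "b > 0"
      using x unfolding half_slice_def by blast
    obtain \<alpha> \<beta> I where z: "Complex \<alpha> \<beta> \<in> D" "I \<in> imag_units" "x = \<alpha> *\<^sub>R one + \<beta> *\<^sub>R I"
      using x circular_setE by blast
    \<comment> \<open>The point may be represented through the unit -J with negative \<beta>;
      symmetry of \<open>D\<close> covers that case.\<close>
    have u: "\<alpha> = a" "\<beta> = b \<or> \<beta> = - b"
      using slice_representation_unique[OF z(2) J, of \<alpha> \<beta> a b] z(3) ab by auto
    have "cnj (Complex \<alpha> \<beta>) = Complex \<alpha> (- \<beta>)" by (simp add: complex_eq_iff)
    hence "Complex a b \<in> D" using u z(1) cnjD[OF z(1)] by auto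
    thus "x \<in> h ` ?U" using ab by (intro image_eqI[of _ _ "Complex a b"]) (auto simp: h_def)
  qed
  have "homeomorphism ?U ?S h k"
  proof (rule homeomorphismI)
    show "continuous_on ?U h" "continuous_on ?S k"
      unfolding h_def k_def by (intro continuous_intros)+
  qed (auto simp: kh simp flip: hS)
  hence "?U homeomorphic ?S" by (auto simp: homeomorphic_def)
  moreover have "simply_connected ?S" using assms J by (auto simp: basic_domain_def)
  ultimately show ?thesis using homeomorphic_simply_connected_eq by blast
qed

theorem ex_model:
  assumes D: "basic_domain D" and u: "u \<in> slice_regular D" "purely_vectorial D u"
  shows "\<exists>g. is_model D u g"
proof -
  have oD: "open D" and cD: "cnj ` D = D"
    using D by (auto simp: basic_domain_def circular_domain_def)
  obtain F where F: "holomorphic_stem D F" "\<And>x. x \<in> circular_set D \<Longrightarrow> u x = induced D F x"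
    using u(1) unfolding slice_regular_def by blast
  have F_stem: "stem_function D F" using F(1) by (simp add: holomorphic_stem_def)
  have F_im: "coord one (F z) = 0" if "z \<in> D" for z
    by (rule purely_vectorial_coord[OF F_stem F(2) u(2) that])
  obtain e1 e2 where e: "e1 \<in> Basis - {one}" "e2 \<in> Basis - {one}" "e1 \<noteq> e2" "e1 \<odot> e2 \<in> imag_units"
    using ex_anticommuting_units by blast
  define K where "K = e1 \<odot> e2"
  have "finite (Basis - {one} :: 'a set)" "Basis - {one} \<noteq> {}" using e by auto
  moreover have "(\<lambda>z. coord e (F z)) holomorphic_on D" if "e \<in> Basis - {one}" for e
    using F(1) that by (simp add: holomorphic_stem_def)
  moreover have "coord e (F (cnj z)) = cnj (coord e (F z))" if "e \<in> Basis - {one}" "z \<in> D" for e z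
    using F_stem that(2) by (simp add: stem_function_def coord_complex_bar)
  ultimately obtain g1 g2 where g: "g1 holomorphic_on D" "g2 holomorphic_on D"
    "\<And>z. g1 (cnj z) = cnj (g1 z)" "\<And>z. g2 (cnj z) = cnj (g2 z)"
    "\<And>z. z \<in> D \<Longrightarrow> g1 z ^ 2 + g2 z ^ 2 = (\<Sum>e\<in>Basis - {one}. coord e (F z) ^ 2)"
    "\<And>p. p \<in> D \<Longrightarrow> min (vanishing_order g1 p) (vanishing_order g2 p)
        = Min ((\<lambda>e. vanishing_order (\<lambda>z. coord e (F z)) p) ` (Basis - {one}))"
    using real_sum_of_two_squares[of "Basis - {one}" D "\<lambda>e z. coord e (F z)",
        OF _ _ oD cD simply_connected_upper_half[OF D]] by blast
  define G where "G = (\<lambda>z. (Re (g1 z) *\<^sub>R e1 + Re (g2 z) *\<^sub>R e2, Im (g1 z) *\<^sub>R e1 + Im (g2 z) *\<^sub>R e2))"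
  have coord_G: "coord b (G z) = (if b = e1 then g1 z else if b = e2 then g2 z else 0)" if "b \<in> Basis" for b z
    using that e by (auto simp: coord_def G_def inner_add_left inner_Basis complex_eq_iff)
  have G_stem: "stem_function D G"
    by (simp add: stem_function_def G_def complex_bar_def g(3,4))
  have G_im: "coord one (G z) = 0" for z
    using coord_G[OF one_Basis] e by auto
  have "(\<lambda>z. coord b (G z)) holomorphic_on D" if "b \<in> Basis" for b
    unfolding coord_G[OF that] using g(1,2) by (cases "b = e1"; cases "b = e2") simp_all
  with G_stem have G: "holomorphic_stem D G" by (simp add: holomorphic_stem_def)
  define f where "f = induced D G"
  have f_reg: "f \<in> slice_regular D" using G by (auto simp: slice_regular_def f_def)
  have fG: "f x = induced D G x" for x by (simp add: f_def)
  have sum_G: "(\<Sum>b\<in>Basis - {one}. coord b (G z) ^ 2) = g1 z ^ 2 + g2 z ^ 2" for z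
  proof -
    have "(\<Sum>b\<in>Basis - {one}. coord b (G z) ^ 2) = (\<Sum>b\<in>{e1, e2}. coord b (G z) ^ 2)"
      using e by (intro sum.mono_neutral_right) (auto simp: coord_G)
    also have "\<dots> = g1 z ^ 2 + g2 z ^ 2" using e by (auto simp: coord_G)
    finally show ?thesis .
  qed
  have "central_divisor D f p = central_divisor D u p" for p
  proof (cases "p \<in> D")
    case True
    \<comment> \<open>The coordinates other than those along \<open>e1\<close> and \<open>e2\<close>
      vanish identically; their infinite order cannot lower the minimum.\<close>
    let ?v = "\<lambda>b. vanishing_order (\<lambda>z. coord b (G z)) p"
    have v: "?v e1 = vanishing_order g1 p" "?v e2 = vanishing_order g2 p"
      "\<And>b. b \<in> Basis - {one} \<Longrightarrow> b \<noteq> e1 \<Longrightarrow> b \<noteq> e2 \<Longrightarrow> ?v b = \<infinity>"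
      using e by (auto simp: coord_G vanishing_order_eq_infinity_iff)
    have "Min (?v ` (Basis - {one})) = min (vanishing_order g1 p) (vanishing_order g2 p)"
    proof (rule Min_eqI)
      show "min (vanishing_order g1 p) (vanishing_order g2 p) \<in> ?v ` (Basis - {one})"
        using e(1,2) v(1,2) by (metis (no_types, lifting) imageI min_def)
      fix y assume "y \<in> ?v ` (Basis - {one})"
      then obtain b where "b \<in> Basis - {one}" "y = ?v b" by blast
      thus "min (vanishing_order g1 p) (vanishing_order g2 p) \<le> y"
        using v by (cases "b = e1"; cases "b = e2") auto
    qed simp
    thus ?thesis
      using central_divisor_eq[OF G_stem fG oD True] central_divisor_eq[OF F_stem F(2) oD True] g(6)[OF True]
      by simp
  qed (simp add: central_divisor_def)
  moreover have "slice_norm D f = slice_norm D u"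
  proof -
    have "slice_norm D u = induced D (\<lambda>z. complex_embed (\<Sum>e\<in>Basis - {one}. coord e (F z) ^ 2))"
      by (rule slice_norm_imaginary[OF F_stem F(2) F_im])
    also have "\<dots> = induced D (\<lambda>z. complex_embed (\<Sum>e\<in>Basis - {one}. coord e (G z) ^ 2))"
      by (rule induced_cong) (simp add: sum_G g(5))
    also have "\<dots> = slice_norm D f"
      by (rule slice_norm_imaginary[OF G_stem fG G_im, symmetric])
    finally show ?thesis ..
  qed
  ultimately have equiv: "strongly_equivalent D f u"
    using f_reg u(1) slice_trace_imaginary[OF G_stem fG G_im] slice_trace_imaginary[OF F_stem F(2) F_im]
    by (auto simp: strongly_equivalent_def)
  have "q \<in> slice K" if q: "isolated_nonreal_zero D f q" for q
  proof -
    obtain \<alpha> \<beta> J where z: "Complex \<alpha> \<beta> \<in> D" and J: "J \<in> imag_units" and qeq: "q = \<alpha> *\<^sub>R one + \<beta> *\<^sub>R J"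
      using q circular_setE unfolding isolated_nonreal_zero_def by blast
    define x where "x = fst (G (Complex \<alpha> \<beta>))"
    define y where "y = snd (G (Complex \<alpha> \<beta>))"
    have f_val: "f (\<alpha> *\<^sub>R one + \<beta> *\<^sub>R I) = x + I \<odot> y" if "I \<in> imag_units" for I
      using induced_eq[OF G_stem z that] by (simp add: f_def x_def y_def)
    have only: "{x \<in> sphere_of q. f x = 0} = {q}" and nonreal: "q \<notin> span {one}"
      using q by (auto simp: isolated_nonreal_zero_def)
    have "f q = 0" using only by blast
    hence xy: "x + J \<odot> y = 0" using f_val[OF J] qeq by simp
    \<comment> \<open>Otherwise x = 0 too, and the conjugate point \<alpha> - \<beta>J would be a
      second zero on the same sphere.\<close>
    have "y \<noteq> 0"
    proof
      assume "y = 0"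
      with xy have "x = 0" by (simp add: mult_simps)
      let ?q = "\<alpha> *\<^sub>R one + \<beta> *\<^sub>R (- J)"
      have "?q \<in> sphere_of q"
        unfolding sphere_of_def using J imag_units_uminus[OF J] qeq by blast
      moreover have "f ?q = 0"
        using f_val[OF imag_units_uminus[OF J]] \<open>x = 0\<close> \<open>y = 0\<close> by (simp add: mult_simps)
      ultimately have "?q = q" using only by blast
      hence "- (\<beta> *\<^sub>R J) = \<beta> *\<^sub>R J" by (simp add: qeq)
      hence "\<beta> *\<^sub>R J = 0" by (simp add: neg_eq_iff_add_eq_0 flip: scaleR_2)
      hence "q = \<alpha> *\<^sub>R one" by (simp only: qeq add_0_right)
      hence "q \<in> span {one}" by (simp add: span_base span_scale)
      with nonreal show False ..
    qed
    have e_im: "e1 \<bullet> one = 0" "e2 \<bullet> one = 0" "e1 \<bullet> e2 = 0" "e1 \<bullet> e1 = 1" "e2 \<bullet> e2 = 1"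
      using e one_Basis by (auto simp: inner_Basis)
    have y_im: "y \<bullet> one = 0" by (simp add: y_def G_def inner_add_left e_im)
    have e21: "e2 \<odot> e1 = - K"
      using imaginary_anticommutator[OF e_im(1,2)] by (simp add: e_im K_def eq_neg_iff_add_eq_0 add.commute)
    \<comment> \<open>Both factors lie in the span of \<open>e1\<close> and \<open>e2\<close>, whose
      squares are -1 and whose mixed products are \<open>K\<close> and \<open>- K\<close>.\<close>
    have "x \<odot> y \<in> span {one, K}"
      by (simp add: x_def y_def G_def mult_simps imaginary_square e_im e21 flip: K_def)
         (intro span_add span_diff span_neg span_scale span_base; simp)
    \<comment> \<open>Multiplying Jy = -x by y on the right solves for J: right alternativity gives
      (Jy)y = J(yy), and yy is real.\<close>
    moreover have "(y \<bullet> y) *\<^sub>R J = x \<odot> y"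
    proof -
      have "J \<odot> y = - x" using xy by (simp add: eq_neg_iff_add_eq_0 add.commute)
      hence "- x \<odot> y = J \<odot> (y \<odot> y)" using right_alternative[of J y] by simp
      also have "\<dots> = - ((y \<bullet> y) *\<^sub>R J)" by (simp add: imaginary_square y_im mult_simps)
      finally show ?thesis by (simp add: mult_simps)
    qed
    ultimately have "inverse (y \<bullet> y) *\<^sub>R ((y \<bullet> y) *\<^sub>R J) \<in> span {one, K}"
      by (simp only: span_scale)
    hence "J \<in> span {one, K}" using \<open>y \<noteq> 0\<close> by simp
    thus ?thesis unfolding qeq slice_def by (intro span_add span_scale) (auto intro: span_base)
  qed
  hence "is_model D u f"
    using f_reg equiv e(4) by (auto simp: is_model_def K_def)
  thus ?thesis by blast
qed

end

section \<open>The quaternions and the octonions\<close>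

lemma quat_alg: "slice_quadratic_algebra quat_mult quat_conj quat_one"
proof
  show "\<exists>e1\<in>Basis - {quat_one}. \<exists>e2\<in>Basis - {quat_one}. e1 \<noteq> e2 \<and> quat_mult e1 e2 \<in> quat.imag_units"
    by (rule bexI[of _ "(\<i>, 0)"], rule bexI[of _ "(0, 1)"])
       (auto simp: slice_algebra.imag_units_def Basis_prod_def Basis_complex_def quat_one_def quat_mult_def cd_mult_def)
  show "bilinear quat_mult"
    by (auto simp: bilinear_def linear_iff quat_mult_def cd_mult_def algebra_simps scaleR_conv_of_real)
qed (auto simp: quat_mult_def quat_conj_def quat_one_def cd_mult_def cd_conj_def prod_eq_iff complex_eq_iff
    Basis_prod_def Basis_complex_def inner_prod_def inner_complex_def algebra_simps)

lemma oct_alg: "slice_quadratic_algebra oct_mult oct_conj oct_one"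
proof
  show "\<exists>e1\<in>Basis - {oct_one}. \<exists>e2\<in>Basis - {oct_one}. e1 \<noteq> e2 \<and> oct_mult e1 e2 \<in> oct.imag_units"
    \<comment> \<open>The quaternions i and j in the first summand; their product is k, as in the
      quaternion case.\<close>
    by (rule bexI[of _ "((\<i>, 0), 0)"], rule bexI[of _ "((0, 1), 0)"])
       (auto simp: slice_algebra.imag_units_def Basis_prod_def Basis_complex_def oct_one_def oct_mult_def oct_conj_def
          quat_one_def quat_mult_def quat_conj_def cd_mult_def cd_conj_def zero_prod_def)
  show "bilinear oct_mult"
    by (auto simp: bilinear_def linear_iff oct_mult_def quat_mult_def quat_conj_def cd_mult_def cd_conj_def
        algebra_simps scaleR_conv_of_real)
  show "oct_one \<in> Basis"
    by (auto simp: oct_one_def quat_one_def Basis_prod_def Basis_complex_def)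
  fix x y :: octonion
  show "oct_mult oct_one x = x" "oct_mult x oct_one = x"
       "oct_conj x = (2 * (x \<bullet> oct_one)) *\<^sub>R oct_one - x"
       "oct_mult x x = (2 * (x \<bullet> oct_one)) *\<^sub>R x - (x \<bullet> x) *\<^sub>R oct_one"
    by (auto simp: oct_mult_def oct_conj_def oct_one_def quat_mult_def quat_conj_def quat_one_def
        cd_mult_def cd_conj_def prod_eq_iff complex_eq_iff inner_prod_def inner_complex_def algebra_simps)
  \<comment> \<open>Splitting down to complex coordinates is enough: there both alternative laws are
    identities in a commutative ring with the involution \<open>cnj\<close>.\<close>
  show "oct_mult x (oct_mult x y) = oct_mult (oct_mult x x) y"
    by (simp add: oct_mult_def oct_conj_def quat_mult_def quat_conj_def cd_mult_def cd_conj_def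
        prod_eq_iff algebra_simps)
  show "oct_mult (oct_mult y x) x = oct_mult y (oct_mult x x)"
    by (simp add: oct_mult_def oct_conj_def quat_mult_def quat_conj_def cd_mult_def cd_conj_def
        prod_eq_iff algebra_simps)
qed

theorem theorem4p8:
  shows "(\<forall>D (u :: quaternion \<Rightarrow> quaternion).
            quat.basic_domain D \<longrightarrow> u \<in> quat.slice_regular D \<longrightarrow> quat.purely_vectorial D u \<longrightarrow>
            (\<exists>g. quat.is_model D u g))
       \<and> (\<forall>D (u :: octonion \<Rightarrow> octonion).
            oct.basic_domain D \<longrightarrow> u \<in> oct.slice_regular D \<longrightarrow> oct.purely_vectorial D u \<longrightarrow>
            (\<exists>g. oct.is_model D u g))"
  using slice_quadratic_algebra.ex_model[OF quat_alg] slice_quadratic_algebra.ex_model[OF oct_alg]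
  by blast

end
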